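(* A displacement field $\mathbf{u}:\Omega\to\mathbb{R}^3$ is universal for the tetragonal class $\mathbb{Z}_4\oplus\mathbb{Z}_2^c$ of linear strain-gradient elastic solids if and only if it is the superposition (sum) of a homogeneous displacement field and a field of the form $$\bigl(c_1x_2x_3+c_2x_1x_3,\; -c_2x_2x_3+c_3x_1x_3,\; g(x_1,x_2)\bigr),$$ where $c_1,c_2,c_3\in\mathbb{R}$ are constants and $g$ is a harmonic function of $(x_1,x_2)$ that can be written as $$g(x_1,x_2)=f_1(x_1)+x_2f_2(x_1)+f_3(x_2)+x_1f_4(x_2)$$ with smooth functions $f_1,\dots,f_4$ of one variable and a constant $c\in\mathbb{R}$ satisfying $f_2'''(x_1)=0$, $f_4'''(x_2)=0$, and $f_3''''(x_2)=-f_1''''(x_1)=c$.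
   Context: $\Omega\subset\mathbb{R}^3$ is a nonempty convex open set with Cartesian coordinates $(x_1,x_2,x_3)$ and orthonormal basis $e_1,e_2,e_3$; functions of $(x_1,x_2)$, of $x_1$, or of $x_2$ are defined on the corresponding projection of $\Omega$. Repeated indices are summed over $1,2,3$ and a comma denotes partial differentiation. A displacement field is a smooth map $\mathbf{u}:\Omega\to\mathbb{R}^3$, with strain $e_{lm}=\tfrac12(u_{l,m}+u_{m,l})$. It is homogeneous if $\mathbf{u}(\mathbf{x})=\mathbf{H}\mathbf{x}+\mathbf{b}$ for a constant matrix $\mathbf{H}$ and constant vector $\mathbf{b}$. A strain-gradient material is a triple $(\mathsf{C},\mathsf{M},\mathsf{A})$ of constant real tensors of orders $4,5,6$ with index symmetries $\mathsf{C}_{ijlm}=\mathsf{C}_{jilm}=\mathsf{C}_{lmij}$, $\mathsf{M}_{ijklm}=\mathsf{M}_{jiklm}=\mathsf{M}_{ijlkm}$, $\mathsf{A}_{ijklmn}=\mathsf{A}_{jiklmn}=\mathsf{A}_{lmnijk}$. Its stress and hyper-stress are $\sigma_{ij}=\mathsf{C}_{ijlm}e_{lm}+\mathsf{M}_{ijlmn}e_{lm,n}$ and $\tau_{ijk}=\mathsf{M}_{lmijk}e_{lm}+\mathsf{A}_{ijklmn}e_{lm,n}$, and the equilibrium equations without body forces are $\sigma_{ij,j}-\tau_{ijk,jk}=0$ in $\Omega$ for $i=1,2,3$. For a subgroup $G\subset \mathrm{O}(3)$, a tensor $T$ of order $p$ is $G$-invariant if $Q_{i_1j_1}\cdots Q_{i_pj_p}T_{j_1\dots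 j_p}=T_{i_1\dots i_p}$ for all $Q\in G$. $\mathbb{Z}_4$ is generated by the rotation by $\pi/2$ about $e_3$; $\mathbb{D}_4$ is generated by $\mathbb{Z}_4$ and the rotation by $\pi$ about $e_1$; $\mathbb{Z}_2^c=\{I,-I\}$, and $G\oplus\mathbb{Z}_2^c$ is the group generated by $G$ and $-I$. The tetragonal class $\mathbb{Z}_4\oplus\mathbb{Z}_2^c$ is the set of all materials with $\mathsf{C}$ $\mathbb{D}_4\oplus\mathbb{Z}_2^c$-invariant (6 independent constants), $\mathsf{M}=0$, and $\mathsf{A}$ $\mathbb{Z}_4\oplus\mathbb{Z}_2^c$-invariant (45 independent constants). A displacement field is universal for the class if it satisfies the equilibrium equations for every material in the class. *)

theory Defs
  imports "HOL-Analysis.Analysis" "HOL-Algebra.Generated_Groups"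
begin

subsection \<open>Smoothness and partial derivatives\<close>

text \<open>
  Maps on a subset of a Euclidean space are total functions of which only the values on that
  subset matter. All sets of differentiation below are open, so the Frechet
  derivative \<open>at x\<close> depends only on the restriction of the map to the set.
\<close>

primrec Ck_on :: "nat \<Rightarrow> 'a::euclidean_space set \<Rightarrow> ('a \<Rightarrow> 'b::real_normed_vector) \<Rightarrow> bool" where
  "Ck_on 0 S f \<longleftrightarrow> continuous_on S f"
| "Ck_on (Suc k) S f \<longleftrightarrow>
     (\<forall>x\<in>S. f differentiable (at x)) \<and> (\<forall>v. Ck_on k S (\<lambda>x. frechet_derivative f (at x) v))"

definition smooth_on :: "'a::euclidean_space set \<Rightarrow> ('a \<Rightarrow> 'b::real_normed_vector) \<Rightarrow> bool" where
  "smooth_on S f \<longleftrightarrow> (\<forall>k. Ck_on k S f)"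

definition partial :: "'n::finite \<Rightarrow> (real^'n \<Rightarrow> real) \<Rightarrow> real^'n \<Rightarrow> real" where
  "partial i f x = frechet_derivative f (at x) (axis i 1)"

definition harmonic_on :: "(real^'n::finite) set \<Rightarrow> (real^'n \<Rightarrow> real) \<Rightarrow> bool" where
  "harmonic_on S g \<longleftrightarrow> Ck_on 2 S g \<and> (\<forall>x\<in>S. (\<Sum>i\<in>UNIV. partial i (partial i g) x) = 0)"


subsection \<open>Displacement fields\<close>

definition displacement_field :: "(real^3) set \<Rightarrow> (real^3 \<Rightarrow> real^3) \<Rightarrow> bool" where
  "displacement_field \<Omega> u \<longleftrightarrow> smooth_on \<Omega> u"

definition homogeneous_on :: "(real^3) set \<Rightarrow> (real^3 \<Rightarrow> real^3) \<Rightarrow> bool" where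
  "homogeneous_on \<Omega> u \<longleftrightarrow> (\<exists>(H::real^3^3) b. \<forall>x\<in>\<Omega>. u x = H *v x + b)"

definition strain :: "(real^3 \<Rightarrow> real^3) \<Rightarrow> 3 \<Rightarrow> 3 \<Rightarrow> real^3 \<Rightarrow> real" where
  "strain u l m x = (partial m (\<lambda>y. u y $ l) x + partial l (\<lambda>y. u y $ m) x) / 2"


subsection \<open>Strain-gradient materials\<close>

type_synonym tensor4 = "3 \<Rightarrow> 3 \<Rightarrow> 3 \<Rightarrow> 3 \<Rightarrow> real"
type_synonym tensor5 = "3 \<Rightarrow> 3 \<Rightarrow> 3 \<Rightarrow> 3 \<Rightarrow> 3 \<Rightarrow> real"
type_synonym tensor6 = "3 \<Rightarrow> 3 \<Rightarrow> 3 \<Rightarrow> 3 \<Rightarrow> 3 \<Rightarrow> 3 \<Rightarrow> real"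
type_synonym material = "tensor4 \<times> tensor5 \<times> tensor6"

definition strain_gradient_materials :: "material set" where
  "strain_gradient_materials = {(C, M, A).
     (\<forall>i j l m. C i j l m = C j i l m \<and> C i j l m = C l m i j) \<and>
     (\<forall>i j k l m. M i j k l m = M j i k l m \<and> M i j k l m = M i j l k m) \<and>
     (\<forall>i j k l m n. A i j k l m n = A j i k l m n \<and> A i j k l m n = A l m n i j k)}"

fun stress :: "material \<Rightarrow> (real^3 \<Rightarrow> real^3) \<Rightarrow> 3 \<Rightarrow> 3 \<Rightarrow> real^3 \<Rightarrow> real" where
  "stress (C, M, A) u i j x =
     (\<Sum>l\<in>UNIV. \<Sum>m\<in>UNIV. C i j l m * strain u l m x) +
     (\<Sum>l\<in>UNIV. \<Sum>m\<in>UNIV. \<Sum>n\<in>UNIV. M i j l m n * partial n (strain u l m) x)"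

fun hyperstress :: "material \<Rightarrow> (real^3 \<Rightarrow> real^3) \<Rightarrow> 3 \<Rightarrow> 3 \<Rightarrow> 3 \<Rightarrow> real^3 \<Rightarrow> real" where
  "hyperstress (C, M, A) u i j k x =
     (\<Sum>l\<in>UNIV. \<Sum>m\<in>UNIV. M l m i j k * strain u l m x) +
     (\<Sum>l\<in>UNIV. \<Sum>m\<in>UNIV. \<Sum>n\<in>UNIV. A i j k l m n * partial n (strain u l m) x)"

definition equilibrium_on :: "(real^3) set \<Rightarrow> material \<Rightarrow> (real^3 \<Rightarrow> real^3) \<Rightarrow> bool" where
  "equilibrium_on \<Omega> K u \<longleftrightarrow> (\<forall>x\<in>\<Omega>. \<forall>i.
     (\<Sum>j\<in>UNIV. partial j (stress K u i j) x) -
     (\<Sum>j\<in>UNIV. \<Sum>k\<in>UNIV. partial k (partial j (hyperstress K u i j k)) x) = 0)"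

text \<open>Universality is a property of displacement fields, that is, of smooth \<open>u\<close>.\<close>

definition universal_on :: "(real^3) set \<Rightarrow> material set \<Rightarrow> (real^3 \<Rightarrow> real^3) \<Rightarrow> bool" where
  "universal_on \<Omega> \<K> u \<longleftrightarrow> (\<forall>K\<in>\<K>. equilibrium_on \<Omega> K u)"


subsection \<open>Symmetry groups\<close>

definition O3 :: "(real^3^3) monoid" where
  "O3 = \<lparr>carrier = {Q. orthogonal_matrix Q}, mult = (**), one = mat 1\<rparr>"

lemma group_O3: "group O3"
proof (rule groupI)
  fix Q assume Q: "Q \<in> carrier O3"
  then have "transpose Q \<in> carrier O3" "transpose Q \<otimes>\<^bsub>O3\<^esub> Q = \<one>\<^bsub>O3\<^esub>"
    by (auto simp: O3_def orthogonal_matrix_def)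
  then show "\<exists>P\<in>carrier O3. P \<otimes>\<^bsub>O3\<^esub> Q = \<one>\<^bsub>O3\<^esub>" by blast
qed (auto simp: O3_def orthogonal_matrix_mul orthogonal_matrix_id matrix_mul_assoc)

definition rotation_e1 :: "real \<Rightarrow> real^3^3" where
  "rotation_e1 t = vector [vector [1, 0, 0],
                           vector [0, cos t, - sin t],
                           vector [0, sin t, cos t]]"

definition rotation_e3 :: "real \<Rightarrow> real^3^3" where
  "rotation_e3 t = vector [vector [cos t, - sin t, 0],
                           vector [sin t, cos t, 0],
                           vector [0, 0, 1]]"

definition Z4 :: "(real^3^3) set" where
  "Z4 = generate O3 {rotation_e3 (pi / 2)}"

definition D4 :: "(real^3^3) set" where
  "D4 = generate O3 (Z4 \<union> {rotation_e1 pi})"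

definition plus_Z2c :: "(real^3^3) set \<Rightarrow> (real^3^3) set" where
  "plus_Z2c G = generate O3 (G \<union> {- mat 1})"

definition invariant4 :: "(real^3^3) set \<Rightarrow> tensor4 \<Rightarrow> bool" where
  "invariant4 G T \<longleftrightarrow> (\<forall>Q\<in>G. \<forall>i1 i2 i3 i4.
     (\<Sum>j1\<in>UNIV. \<Sum>j2\<in>UNIV. \<Sum>j3\<in>UNIV. \<Sum>j4\<in>UNIV.
        Q$i1$j1 * Q$i2$j2 * Q$i3$j3 * Q$i4$j4 * T j1 j2 j3 j4) = T i1 i2 i3 i4)"

definition invariant6 :: "(real^3^3) set \<Rightarrow> tensor6 \<Rightarrow> bool" where
  "invariant6 G T \<longleftrightarrow> (\<forall>Q\<in>G. \<forall>i1 i2 i3 i4 i5 i6.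
     (\<Sum>j1\<in>UNIV. \<Sum>j2\<in>UNIV. \<Sum>j3\<in>UNIV. \<Sum>j4\<in>UNIV. \<Sum>j5\<in>UNIV. \<Sum>j6\<in>UNIV.
        Q$i1$j1 * Q$i2$j2 * Q$i3$j3 * Q$i4$j4 * Q$i5$j5 * Q$i6$j6 * T j1 j2 j3 j4 j5 j6)
     = T i1 i2 i3 i4 i5 i6)"

definition tetragonal_Z4_Z2c :: "material set" where
  "tetragonal_Z4_Z2c = {(C, M, A) \<in> strain_gradient_materials.
     invariant4 (plus_Z2c D4) C \<and> M = (\<lambda>i j k l m. 0) \<and> invariant6 (plus_Z2c Z4) A}"


subsection \<open>Projections of the domain\<close>

definition proj12 :: "real^3 \<Rightarrow> real^2" where
  "proj12 x = vector [x $ 1, x $ 2]"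

end

theory Submission
  imports Defs
begin

text \<open>
  For \<open>M = 0\<close> and constant tensors the equilibrium equations read
  \<open>C\<^sub>i\<^sub>j\<^sub>l\<^sub>m u\<^sub>l\<^sub>,\<^sub>m\<^sub>j - A\<^sub>i\<^sub>j\<^sub>k\<^sub>l\<^sub>m\<^sub>n u\<^sub>l\<^sub>,\<^sub>m\<^sub>n\<^sub>j\<^sub>k = 0\<close>, and the choices of \<open>C\<close> and \<open>A\<close> are independent. Varying the six
  elastic constants with \<open>A = 0\<close> annihilates all second derivatives of \<open>u\<^sub>1\<close> and \<open>u\<^sub>2\<close> except
  \<open>u\<^sub>1\<^sub>,\<^sub>1\<^sub>3 = - u\<^sub>2\<^sub>,\<^sub>2\<^sub>3\<close>, \<open>u\<^sub>1\<^sub>,\<^sub>2\<^sub>3\<close>, \<open>u\<^sub>2\<^sub>,\<^sub>1\<^sub>3\<close>, which are then constant, and makes \<open>u\<^sub>3\<close> a harmonic function of \<open>(x\<^sub>1, x\<^sub>2)\<close>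
  plus a multiple of \<open>x\<^sub>3\<close>. Two tensors \<open>A\<close> built from the \<open>Z\<^sub>4\<close>-invariant binary quartic forms
  \<open>x\<^sup>2y\<^sup>2\<close> and \<open>x\<^sup>3y - xy\<^sup>3\<close> give \<open>u\<^sub>3\<^sub>,\<^sub>1\<^sub>1\<^sub>2\<^sub>2 = 0\<close> and \<open>u\<^sub>3\<^sub>,\<^sub>1\<^sub>1\<^sub>1\<^sub>2 = u\<^sub>3\<^sub>,\<^sub>1\<^sub>2\<^sub>2\<^sub>2\<close>; together with harmonicity all
  fourth derivatives of \<open>u\<^sub>3\<close> vanish, so \<open>g\<close> is a harmonic cubic. Conversely, the conditions on
  \<open>f\<^sub>1, \<dots>, f\<^sub>4\<close> make every admissible \<open>g\<close> a polynomial whose only possibly nonzero fourth derivatives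
  are \<open>g\<^sub>,\<^sub>2\<^sub>2\<^sub>2\<^sub>2 = - g\<^sub>,\<^sub>1\<^sub>1\<^sub>1\<^sub>1\<close>, and these cancel because \<open>A\<^sub>3\<^sub>1\<^sub>1\<^sub>3\<^sub>1\<^sub>1 = A\<^sub>3\<^sub>2\<^sub>2\<^sub>3\<^sub>2\<^sub>2\<close>.
\<close>

subsection \<open>Smooth functions and partial derivatives\<close>

text \<open>Both maps satisfy the same \<open>has_derivative\<close> predicate at \<open>x\<close>,
  so the same value is chosen as \<open>frechet_derivative\<close>. This is what lets an identity
  valid only on an open set be differentiated there.\<close>

lemma frechet_derivative_cong_open:
  assumes "open S" "x \<in> S" "\<And>y. y \<in> S \<Longrightarrow> f y = g y"
  shows "frechet_derivative f (at x) = frechet_derivative g (at x)"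
proof -
  have "(f has_derivative D) (at x) \<longleftrightarrow> (g has_derivative D) (at x)" for D
    using has_derivative_transform_within_open[OF _ assms(1,2), of f D UNIV g]
      has_derivative_transform_within_open[OF _ assms(1,2), of g D UNIV f] assms(3)
    by (metis (full_types))
  then show ?thesis unfolding frechet_derivative_def by simp
qed

lemma partial_cong_open:
  assumes "open S" "x \<in> S" "\<And>y. y \<in> S \<Longrightarrow> f y = g y"
  shows "partial i f x = partial i g x"
  using frechet_derivative_cong_open[OF assms] by (simp add: partial_def)

lemma partial_has_derivative: "(f has_derivative f') (at x) \<Longrightarrow> partial i f x = f' (axis i 1)"
  using frechet_derivative_at unfolding partial_def by metis

lemma Ck_on_cong:
  assumes "open S" "\<And>y. y \<in> S \<Longrightarrow> f y = g y"
  shows "Ck_on k S f \<longleftrightarrow> Ck_on k S g"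
  using assms(2)
proof (induction k arbitrary: f g)
  case 0
  then show ?case using continuous_on_cong by fastforce
next
  case (Suc k)
  have "f differentiable (at x) \<longleftrightarrow> g differentiable (at x)" if "x \<in> S" for x
    using has_derivative_transform_within_open[OF _ assms(1) that, of f _ UNIV g]
      has_derivative_transform_within_open[OF _ assms(1) that, of g _ UNIV f] Suc.prems
    unfolding differentiable_def by (metis (full_types))
  moreover have "Ck_on k S (\<lambda>x. frechet_derivative f (at x) v) \<longleftrightarrow>
      Ck_on k S (\<lambda>x. frechet_derivative g (at x) v)" for v
    using frechet_derivative_cong_open[OF assms(1) _ Suc.prems] by (intro Suc.IH) simp
  ultimately show ?case by simp
qed

text \<open>Trades the derivative picked by \<open>frechet_derivative\<close> for an explicit
  formula, so that the closure rules for sums, products and linear images reduce to the usual rules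
  of differentiation and an induction on the order.\<close>

lemma Ck_on_SucI:
  assumes "open S" "\<And>x. x \<in> S \<Longrightarrow> (f has_derivative f' x) (at x)"
    and "\<And>v. Ck_on k S (\<lambda>x. f' x v)"
  shows "Ck_on (Suc k) S f"
proof -
  have "frechet_derivative f (at x) = f' x" if "x \<in> S" for x
    using assms(2)[OF that] frechet_derivative_at by metis
  then have "Ck_on k S (\<lambda>x. frechet_derivative f (at x) v)" for v
    using Ck_on_cong[OF assms(1), of "\<lambda>x. frechet_derivative f (at x) v" "\<lambda>x. f' x v"] assms(3)
    by simp
  then show ?thesis using assms(2) by (auto simp: differentiable_def)
qed

lemma Ck_on_SucD:
  assumes "Ck_on (Suc k) S f" "x \<in> S"
  shows "(f has_derivative frechet_derivative f (at x)) (at x)"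
  using assms frechet_derivative_works by auto

lemma Ck_on_Suc_imp: "Ck_on (Suc k) S f \<Longrightarrow> Ck_on k S f"
proof (induction k arbitrary: f)
  case 0
  then show ?case
    by (auto intro!: continuous_at_imp_continuous_on differentiable_imp_continuous_within)
next
  case (Suc k)
  then show ?case by (metis Ck_on.simps(2))
qed

lemma Ck_on_const: "open S \<Longrightarrow> Ck_on k S (\<lambda>x. c)"
proof (induction k arbitrary: c)
  case (Suc k)
  then show ?case by (intro Ck_on_SucI[where f' = "\<lambda>_ _. 0"]) auto
qed simp

lemma Ck_on_bounded_linear:
  assumes "open S" "bounded_linear L"
  shows "Ck_on k S f \<Longrightarrow> Ck_on k S (\<lambda>x. L (f x))"
proof (induction k arbitrary: f)
  case 0
  then show ?case using bounded_linear.continuous_on[OF assms(2)] by simp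
next
  case (Suc k)
  show ?case
  proof (rule Ck_on_SucI[OF assms(1)])
    show "((\<lambda>x. L (f x)) has_derivative (\<lambda>v. L (frechet_derivative f (at x) v))) (at x)"
      if "x \<in> S" for x
      using bounded_linear.has_derivative[OF assms(2) Ck_on_SucD[OF Suc.prems that]] .
  qed (use Suc in simp)
qed

lemma Ck_on_add:
  assumes "open S"
  shows "Ck_on k S f \<Longrightarrow> Ck_on k S g \<Longrightarrow> Ck_on k S (\<lambda>x. f x + g x)"
proof (induction k arbitrary: f g)
  case 0
  then show ?case by (simp add: continuous_on_add)
next
  case (Suc k)
  show ?case
    by (rule Ck_on_SucI[OF assms has_derivative_add[OF Ck_on_SucD[OF Suc.prems(1)] Ck_on_SucD[OF Suc.prems(2)]]])
      (use Suc in auto)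
qed

lemma Ck_on_mult:
  fixes f g :: "'a::euclidean_space \<Rightarrow> 'b::real_normed_algebra"
  assumes "open S"
  shows "Ck_on k S f \<Longrightarrow> Ck_on k S g \<Longrightarrow> Ck_on k S (\<lambda>x. f x * g x)"
proof (induction k arbitrary: f g)
  case 0
  then show ?case by (simp add: continuous_on_mult)
next
  case (Suc k)
  \<comment> \<open>The product rule leaves one factor undifferentiated; it is lowered from order
    \<open>Suc k\<close> to \<open>k\<close> to fit the induction hypothesis.\<close>
  have "Ck_on k S f" "Ck_on k S g" using Suc.prems Ck_on_Suc_imp by blast+
  then show ?case
    by (intro Ck_on_SucI[OF assms has_derivative_mult[OF Ck_on_SucD[OF Suc.prems(1)] Ck_on_SucD[OF Suc.prems(2)]]])
      (use Suc in \<open>auto intro!: Ck_on_add[OF assms]\<close>)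
qed

lemma Ck_on_linear:
  assumes "open S" "bounded_linear L"
  shows "Ck_on k S L"
proof (cases k)
  case 0
  then show ?thesis using linear_continuous_on[OF assms(2)] by simp
next
  case (Suc m)
  then show ?thesis
    using Ck_on_SucI[OF assms(1), where f = L and f' = "\<lambda>_. L"] bounded_linear_imp_has_derivative[OF assms(2)]
      Ck_on_const[OF assms(1)] by blast
qed

lemma smooth_on_frechet: "smooth_on S f \<Longrightarrow> smooth_on S (\<lambda>x. frechet_derivative f (at x) v)"
  unfolding smooth_on_def by (metis Ck_on.simps(2))

lemma smooth_on_partial: "smooth_on S f \<Longrightarrow> smooth_on S (partial i f)"
  using smooth_on_frechet[of S f "axis i 1"] by (simp add: partial_def[abs_def])

lemma smooth_on_differentiable: "smooth_on S f \<Longrightarrow> x \<in> S \<Longrightarrow> f differentiable (at x)"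
  unfolding smooth_on_def by (metis Ck_on.simps(2))

lemma smooth_on_continuous: "smooth_on S f \<Longrightarrow> continuous_on S f"
  unfolding smooth_on_def by (metis Ck_on.simps(1))

lemma smooth_on_has_derivative:
  "smooth_on S f \<Longrightarrow> x \<in> S \<Longrightarrow> (f has_derivative frechet_derivative f (at x)) (at x)"
  using smooth_on_differentiable frechet_derivative_works by blast

lemma smooth_on_const: "open S \<Longrightarrow> smooth_on S (\<lambda>x. c)"
  by (simp add: smooth_on_def Ck_on_const)

lemma smooth_on_add:
  "open S \<Longrightarrow> smooth_on S f \<Longrightarrow> smooth_on S g \<Longrightarrow> smooth_on S (\<lambda>x. f x + g x)"
  by (simp add: smooth_on_def Ck_on_add)

lemma smooth_on_mult:
  fixes f g :: "'a::euclidean_space \<Rightarrow> 'b::real_normed_algebra"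
  shows "open S \<Longrightarrow> smooth_on S f \<Longrightarrow> smooth_on S g \<Longrightarrow> smooth_on S (\<lambda>x. f x * g x)"
  by (simp add: smooth_on_def Ck_on_mult)

lemma smooth_on_linear: "open S \<Longrightarrow> bounded_linear L \<Longrightarrow> smooth_on S L"
  by (simp add: smooth_on_def Ck_on_linear)

lemma smooth_on_component:
  fixes f :: "'a::euclidean_space \<Rightarrow> real^'n"
  shows "open S \<Longrightarrow> smooth_on S f \<Longrightarrow> smooth_on S (\<lambda>x. f x $ i)"
  unfolding smooth_on_def using Ck_on_bounded_linear[OF _ bounded_linear_vec_nth] by blast

lemma partial_add:
  "f differentiable (at x) \<Longrightarrow> g differentiable (at x) \<Longrightarrow>
    partial i (\<lambda>x. f x + g x) x = partial i f x + partial i g x"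
  by (rule partial_has_derivative[THEN trans])
    (auto intro!: has_derivative_add simp: frechet_derivative_works[symmetric] partial_def)

lemma partial_mult:
  "f differentiable (at x) \<Longrightarrow> g differentiable (at x) \<Longrightarrow>
    partial i (\<lambda>x. f x * g x) x = f x * partial i g x + partial i f x * g x"
  by (rule partial_has_derivative[THEN trans])
    (auto intro!: has_derivative_mult simp: frechet_derivative_works[symmetric] partial_def)

lemma partial_const: "partial i (\<lambda>x. c) = (\<lambda>x. 0)"
  by (simp add: partial_def[abs_def])

lemma partial_cmult:
  "f differentiable (at x) \<Longrightarrow> partial i (\<lambda>x. c * f x) x = c * partial i f x"
  by (simp add: partial_mult partial_const)

lemma partial_nth: "partial i (\<lambda>x. x $ j) = (\<lambda>x. of_bool (i = j))"
  by (auto simp: fun_eq_iff axis_def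
      intro!: partial_has_derivative[THEN trans] bounded_linear_imp_has_derivative bounded_linear_vec_nth)

lemma partial_sum:
  "(\<And>a. a \<in> I \<Longrightarrow> f a differentiable (at x)) \<Longrightarrow>
    partial i (\<lambda>x. \<Sum>a\<in>I. f a x) x = (\<Sum>a\<in>I. partial i (f a) x)"
  by (induction I rule: infinite_finite_induct) (simp_all add: partial_const partial_add)

lemma partial_of_constant_on:
  assumes "open S" "x \<in> S" "\<And>y. y \<in> S \<Longrightarrow> f y = c" 
  shows "partial i f x = 0"
  using partial_cong_open[OF assms(1,2), of f "\<lambda>_. c"] assms(3) by (simp add: partial_const)

section \<open>Symmetry of second derivatives and integration of gradients\<close>

text \<open>Two applications of the mean value theorem, first along \<open>a\<close> and then along
  \<open>b\<close>, turn the second difference over a parallelogram into a mixed derivative at one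
  of its points.\<close>

lemma second_difference_mean_value:
  fixes f :: "'a::euclidean_space \<Rightarrow> real"
  assumes "smooth_on S f" "cball x (h * (norm a + norm b)) \<subseteq> S" "h > 0"
  shows "\<exists>y\<in>cball x (h * (norm a + norm b)). f (x + h *\<^sub>R a + h *\<^sub>R b) - f (x + h *\<^sub>R a) - f (x + h *\<^sub>R b) + f x
    = h\<^sup>2 * frechet_derivative (\<lambda>x. frechet_derivative f (at x) a) (at y) b"
proof -
  define F where "F = (\<lambda>x. frechet_derivative f (at x) a)"
  have in_ball: "x + s *\<^sub>R a + t *\<^sub>R b \<in> cball x (h * (norm a + norm b))"
    if "0 \<le> s" "s \<le> h" "0 \<le> t" "t \<le> h" for s t
  proof -
    have "norm (s *\<^sub>R a + t *\<^sub>R b) \<le> s * norm a + t * norm b"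
      using norm_triangle_ineq[of "s *\<^sub>R a" "t *\<^sub>R b"] that by simp
    also have "\<dots> \<le> h * norm a + h * norm b"
      using that by (intro add_mono mult_right_mono) auto
    finally have "dist (x + (s *\<^sub>R a + t *\<^sub>R b)) x \<le> h * (norm a + norm b)"
      by (simp add: dist_norm ring_distribs)
    then show ?thesis by (simp add: dist_commute add.assoc)
  qed
  have dfs: "((\<lambda>s. f (x + s *\<^sub>R a + t *\<^sub>R b)) has_real_derivative F (x + s *\<^sub>R a + t *\<^sub>R b)) (at s)"
    if "0 \<le> s" "s \<le> h" "0 \<le> t" "t \<le> h" for s t
  proof -
    let ?D = "frechet_derivative f (at (x + s *\<^sub>R a + t *\<^sub>R b))"
    have D: "(f has_derivative ?D) (at (x + s *\<^sub>R a + t *\<^sub>R b))"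
      using smooth_on_has_derivative[OF assms(1)] in_ball[OF that] assms(2) by auto
    have "((\<lambda>s. f (x + s *\<^sub>R a + t *\<^sub>R b)) has_derivative (\<lambda>r. ?D (r *\<^sub>R a))) (at s)"
      by (rule has_derivative_compose[where f = "\<lambda>s. x + s *\<^sub>R a + t *\<^sub>R b" and g = f])
        (use D in \<open>auto intro!: derivative_eq_intros\<close>)
    then show ?thesis
      using linear_scale[OF has_derivative_linear[OF D]]
      by (simp add: has_field_derivative_def F_def mult_commute_abs)
  qed
  have dFt: "((\<lambda>t. F (x + s *\<^sub>R a + t *\<^sub>R b)) has_real_derivative
      frechet_derivative F (at (x + s *\<^sub>R a + t *\<^sub>R b)) b) (at t)"
    if "0 \<le> s" "s \<le> h" "0 \<le> t" "t \<le> h" for s t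
  proof -
    let ?D = "frechet_derivative F (at (x + s *\<^sub>R a + t *\<^sub>R b))"
    have D: "(F has_derivative ?D) (at (x + s *\<^sub>R a + t *\<^sub>R b))"
      unfolding F_def
      using smooth_on_has_derivative[OF smooth_on_frechet[OF assms(1)]] in_ball[OF that] assms(2) by auto
    have "((\<lambda>t. F (x + s *\<^sub>R a + t *\<^sub>R b)) has_derivative (\<lambda>r. ?D (r *\<^sub>R b))) (at t)"
      by (rule has_derivative_compose[where f = "\<lambda>t. x + s *\<^sub>R a + t *\<^sub>R b" and g = F])
        (use D in \<open>auto intro!: derivative_eq_intros\<close>)
    then show ?thesis
      using linear_scale[OF has_derivative_linear[OF D]]
      by (simp add: has_field_derivative_def mult_commute_abs)
  qed
  \<comment> \<open>The increment of \<open>\<phi>\<close> from \<open>0\<close> to \<open>h\<close>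
    is the second difference.\<close>
  define \<phi> where "\<phi> = (\<lambda>s. f (x + s *\<^sub>R a + h *\<^sub>R b) - f (x + s *\<^sub>R a + 0 *\<^sub>R b))"
  have "\<exists>s. 0 < s \<and> s < h \<and> \<phi> h - \<phi> 0 = (h - 0) * (F (x + s *\<^sub>R a + h *\<^sub>R b) - F (x + s *\<^sub>R a + 0 *\<^sub>R b))"
    unfolding \<phi>_def using assms(3) by (intro MVT2) (auto intro!: DERIV_diff dfs dfs[where t = 0, simplified])
  then obtain s where s: "0 < s" "s < h"
    "\<phi> h - \<phi> 0 = h * (F (x + s *\<^sub>R a + h *\<^sub>R b) - F (x + s *\<^sub>R a + 0 *\<^sub>R b))" by auto
  have "\<exists>t. 0 < t \<and> t < h \<and> F (x + s *\<^sub>R a + h *\<^sub>R b) - F (x + s *\<^sub>R a + 0 *\<^sub>R b)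
      = (h - 0) * frechet_derivative F (at (x + s *\<^sub>R a + t *\<^sub>R b)) b"
    using assms(3) s by (intro MVT2) (auto intro!: dFt dFt[where t = 0, simplified])
  then obtain t where t: "0 < t" "t < h" "F (x + s *\<^sub>R a + h *\<^sub>R b) - F (x + s *\<^sub>R a + 0 *\<^sub>R b)
      = h * frechet_derivative F (at (x + s *\<^sub>R a + t *\<^sub>R b)) b" by auto
  have "\<phi> h - \<phi> 0 = h\<^sup>2 * frechet_derivative F (at (x + s *\<^sub>R a + t *\<^sub>R b)) b"
    using s(3) t(3) by (simp add: power2_eq_square)
  then show ?thesis
    using in_ball[of s t] s t unfolding \<phi>_def F_def
    by (intro bexI[of _ "x + s *\<^sub>R a + t *\<^sub>R b"]) (auto simp: algebra_simps)
qed

text \<open>The second difference is symmetric in \<open>a\<close> and \<open>b\<close>, so the two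
  mixed derivatives agree when taken at suitable points \<open>y\<close> and \<open>z\<close>, both
  arbitrarily close to \<open>x\<close>. Continuity of the mixed derivatives then gives equality at
  \<open>x\<close>.\<close>

lemma frechet_derivative_commute:
  fixes f :: "'a::euclidean_space \<Rightarrow> real"
  assumes "open S" "smooth_on S f" "x \<in> S"
  shows "frechet_derivative (\<lambda>x. frechet_derivative f (at x) a) (at x) b
    = frechet_derivative (\<lambda>x. frechet_derivative f (at x) b) (at x) a"
proof -
  define p where "p = (\<lambda>x. frechet_derivative (\<lambda>x. frechet_derivative f (at x) a) (at x) b)"
  define q where "q = (\<lambda>x. frechet_derivative (\<lambda>x. frechet_derivative f (at x) b) (at x) a)"
  have close: "\<bar>p x - q x\<bar> \<le> e" if "e > 0" for e
  proof -
    have "continuous (at x) p" "continuous (at x) q"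
      unfolding p_def q_def
      using assms by (auto simp: continuous_on_eq_continuous_at[symmetric]
        intro!: smooth_on_continuous smooth_on_frechet continuous_on_interior simp: interior_open)
    then obtain d1 d2 where d: "d1 > 0" "\<And>y. dist y x < d1 \<Longrightarrow> dist (p y) (p x) < e / 2"
      "d2 > 0" "\<And>y. dist y x < d2 \<Longrightarrow> dist (q y) (q x) < e / 2"
      using \<open>e > 0\<close> unfolding continuous_at_eps_delta by (metis half_gt_zero)
    obtain d3 where d3: "d3 > 0" "cball x d3 \<subseteq> S"
      using assms(1,3) open_contains_cball by blast
    define r where "r = min d3 (min (d1 / 2) (d2 / 2))"
    have r: "0 < r" "r \<le> d3" "r < d1" "r < d2" using d(1,3) d3(1) by (auto simp: r_def min_def)
    \<comment> \<open>The summand \<open>1\<close> keeps the denominator positive when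
      \<open>a\<close> and \<open>b\<close> both vanish.\<close>
    define h where "h = r / (norm a + norm b + 1)"
    have h: "h > 0" using r by (simp add: h_def add_nonneg_pos)
    have hr: "h * (norm a + norm b) \<le> r"
    proof -
      have "norm a + norm b + 1 > 0" by (simp add: add_nonneg_pos)
      moreover have "r * (norm a + norm b) \<le> r * (norm a + norm b + 1)" using r(1) by simp
      ultimately show ?thesis by (simp add: h_def pos_divide_le_eq)
    qed
    then have sub: "cball x (h * (norm a + norm b)) \<subseteq> S" using r d3 by force
    obtain y where y: "y \<in> cball x (h * (norm a + norm b))"
      "f (x + h *\<^sub>R a + h *\<^sub>R b) - f (x + h *\<^sub>R a) - f (x + h *\<^sub>R b) + f x = h\<^sup>2 * p y"
      using second_difference_mean_value[OF assms(2) sub h] by (auto simp: p_def)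
    obtain z where z: "z \<in> cball x (h * (norm a + norm b))"
      "f (x + h *\<^sub>R b + h *\<^sub>R a) - f (x + h *\<^sub>R b) - f (x + h *\<^sub>R a) + f x = h\<^sup>2 * q z"
      using second_difference_mean_value[OF assms(2), of x h b a] sub h by (auto simp: q_def add.commute)
    have "h\<^sup>2 * p y = h\<^sup>2 * q z" using y(2) z(2) by (simp add: algebra_simps)
    then have "p y = q z" using h by simp
    moreover have "dist y x < d1" "dist z x < d2"
      using y(1) z(1) hr r by (auto simp: dist_commute)
    ultimately show ?thesis using d(2)[of y] d(4)[of z] unfolding dist_real_def by linarith
  qed
  have "\<bar>p x - q x\<bar> \<le> 0" by (rule field_le_epsilon) (use close in auto)
  then show ?thesis by (simp add: p_def q_def)
qed

lemma partial_commute: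
  assumes "open S" "smooth_on S f" "x \<in> S"
  shows "partial i (partial j f) x = partial j (partial i f) x"
  using frechet_derivative_commute[OF assms] by (simp add: partial_def[abs_def])

text \<open>The derivatives of \<open>f\<close> and \<open>P\<close> are linear maps that agree on
  the standard basis, so \<open>f - P\<close> has zero derivative on a convex set. All later
  integrations guess an antiderivative \<open>P\<close> and compare partial derivatives.\<close>

lemma eq_plus_constant_of_partials:
  fixes f P :: "real^'n \<Rightarrow> real"
  assumes "open S" "convex S" "smooth_on S f" "smooth_on S P"
    and "\<And>x i. x \<in> S \<Longrightarrow> partial i f x = partial i P x"
  shows "\<exists>k. \<forall>x\<in>S. f x = P x + k"
proof -
  have "((\<lambda>x. f x - P x) has_derivative (\<lambda>h. 0)) (at x within S)" if x: "x \<in> S" for x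
  proof -
    let ?f = "frechet_derivative f (at x)" and ?P = "frechet_derivative P (at x)"
    have d: "(f has_derivative ?f) (at x)" "(P has_derivative ?P) (at x)"
      using smooth_on_has_derivative assms x by auto
    have "?f = ?P"
    proof (rule linear_eq_stdbasis)
      show "linear ?f" "linear ?P" using d has_derivative_linear by auto
      show "?f b = ?P b" if "b \<in> Basis" for b
        using that assms(5)[OF x] by (auto simp: Basis_vec_def partial_def)
    qed
    then show ?thesis using has_derivative_diff[OF d] by (simp add: has_derivative_at_withinI)
  qed
  then have "\<exists>k. \<forall>x\<in>S. f x - P x = k"
    using has_derivative_zero_constant[OF assms(2)] by blast
  then show ?thesis by (metis add.commute diff_add_cancel)
qed

subsection \<open>Signed permutation matrices and the tetragonal groups\<close>

text \<open>Row \<open>i\<close> has its only nonzero entry \<open>s i\<close> in column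
  \<open>p i\<close>, so each sum over an index in the invariance conditions collapses to a single
  term.\<close>

definition signed_perm :: "(3 \<Rightarrow> 3) \<Rightarrow> (3 \<Rightarrow> real) \<Rightarrow> real^3^3" where
  "signed_perm p s = (\<chi> i j. if j = p i then s i else 0)"

definition swap12 :: "3 \<Rightarrow> 3" where
  "swap12 i = (if i = 1 then 2 else if i = 2 then 1 else i)"

lemma swap12_simps [simp]: "swap12 1 = 2" "swap12 2 = 1" "swap12 3 = 3" "swap12 \<circ> swap12 = id"
  "swap12 (swap12 i) = i"
  by (simp_all add: swap12_def fun_eq_iff)

lemma swap12_neq_id [simp]: "swap12 \<noteq> id" "id \<noteq> swap12"
proof -
  have "swap12 1 \<noteq> id 1" by simp
  then show "swap12 \<noteq> id" "id \<noteq> swap12" by metis+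
qed

lemma swap12_eq_iff [simp]: "swap12 i = swap12 j \<longleftrightarrow> i = j" "swap12 i = 3 \<longleftrightarrow> i = 3"
  by (metis swap12_simps(5)) (metis swap12_simps(3,5))

lemma sum_signed_perm: "(\<Sum>j\<in>UNIV. signed_perm p s $ i $ j * F j) = s i * F (p i)"
  by (simp add: signed_perm_def if_distrib if_distribR cong: if_cong)

lemma signed_perm_mult:
  "signed_perm p s ** signed_perm q t = signed_perm (q \<circ> p) (\<lambda>i. s i * t (p i))"
  by (simp add: vec_eq_iff matrix_matrix_mult_def sum_signed_perm) (simp add: signed_perm_def)

lemma signed_perm_id: "signed_perm id (\<lambda>_. 1) = mat 1"
  by (auto simp: signed_perm_def mat_def vec_eq_iff)

text \<open>For an involution \<open>p\<close> and signs \<open>s\<close>, the pair of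
  \<open>p\<close> and \<open>\<lambda>i. s (p i)\<close> gives the inverse and also the transpose,
  whence orthogonality and closure under inverses.\<close>

lemma subgroup_signed_perm:
  assumes K: "\<And>p s. (p, s) \<in> K \<Longrightarrow> p \<circ> p = id \<and> (\<forall>i. s i * s i = 1)"
    and one: "(id, \<lambda>_. 1) \<in> K"
    and mult: "\<And>p s q t. (p, s) \<in> K \<Longrightarrow> (q, t) \<in> K \<Longrightarrow> (q \<circ> p, \<lambda>i. s i * t (p i)) \<in> K"
    and inv: "\<And>p s. (p, s) \<in> K \<Longrightarrow> (p, \<lambda>i. s (p i)) \<in> K"
  shows "subgroup ((\<lambda>(p, s). signed_perm p s) ` K) O3"
proof -
  have inverse: "signed_perm p (\<lambda>i. s (p i)) ** signed_perm p s = mat 1"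
    "signed_perm p s ** signed_perm p (\<lambda>i. s (p i)) = mat 1" if "(p, s) \<in> K" for p s
    using K[OF that] by (simp_all add: signed_perm_mult signed_perm_id[symmetric] pointfree_idE)
  have transp: "transpose (signed_perm p s) = signed_perm p (\<lambda>i. s (p i))" if "(p, s) \<in> K" for p s
    using K[OF that] by (auto simp: signed_perm_def transpose_def vec_eq_iff pointfree_idE)
  have in_O3: "signed_perm p s \<in> carrier O3" if "(p, s) \<in> K" for p s
    using inverse[OF that] transp[OF that] by (simp add: O3_def orthogonal_matrix_def)
  show ?thesis
  proof
    show "(\<lambda>(p, s). signed_perm p s) ` K \<subseteq> carrier O3" using in_O3 by auto
    show "\<one>\<^bsub>O3\<^esub> \<in> (\<lambda>(p, s). signed_perm p s) ` K"
      using one by (auto simp: O3_def signed_perm_id[symmetric] intro!: image_eqI[OF _ one])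
    fix P Q assume P: "P \<in> (\<lambda>(p, s). signed_perm p s) ` K"
    then obtain p s where ps: "(p, s) \<in> K" "P = signed_perm p s" by auto
    have "inv\<^bsub>O3\<^esub> P = signed_perm p (\<lambda>i. s (p i))"
      using inverse[OF ps(1)] in_O3[OF ps(1)] in_O3[OF inv[OF ps(1)]] ps(2)
      by (intro group.inv_equality[OF group_O3]) (auto simp: O3_def)
    then show "inv\<^bsub>O3\<^esub> P \<in> (\<lambda>(p, s). signed_perm p s) ` K"
      using inv[OF ps(1)] by auto
    assume "Q \<in> (\<lambda>(p, s). signed_perm p s) ` K"
    then obtain q t where qt: "(q, t) \<in> K" "Q = signed_perm q t" by auto
    show "P \<otimes>\<^bsub>O3\<^esub> Q \<in> (\<lambda>(p, s). signed_perm p s) ` K"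
      using mult[OF ps(1) qt(1)] ps(2) qt(2) by (auto simp: O3_def signed_perm_mult)
  qed
qed

text \<open>A pair \<open>(p, s)\<close> encodes \<open>signed_perm p s\<close>. The rotation by a quarter turn swaps the first two axes
  with exactly one sign change, whence the sign condition for \<open>Z4\<close>; the third sign is free because of \<open>- mat 1\<close>.\<close>

definition D4_pairs :: "((3 \<Rightarrow> 3) \<times> (3 \<Rightarrow> real)) set" where
  "D4_pairs = {(p, s). p \<in> {id, swap12} \<and> (\<forall>i. s i * s i = 1)}"

definition Z4_pairs :: "((3 \<Rightarrow> 3) \<times> (3 \<Rightarrow> real)) set" where
  "Z4_pairs = {(p, s) \<in> D4_pairs. s 1 * s 2 = (if p = id then 1 else -1)}"

lemma signs_mult: "a * a = 1 \<Longrightarrow> b * b = 1 \<Longrightarrow> a * b * (a * b) = (1::real)"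
  by (metis mult.assoc mult.left_commute mult.right_neutral)

lemma D4_pairs_subgroup: "subgroup ((\<lambda>(p, s). signed_perm p s) ` D4_pairs) O3"
  by (rule subgroup_signed_perm) (auto simp: D4_pairs_def intro: signs_mult)

text \<open>The condition on \<open>s 1 * s 2\<close> says that the upper left block of the matrix
  has determinant 1. It is multiplicative because \<open>p\<close> permutes the indices 1 and 2,
  which gives \<open>(s 1 * s 2) * (t 1 * t 2)\<close> for a product.\<close>

lemma Z4_pairs_subgroup: "subgroup ((\<lambda>(p, s). signed_perm p s) ` Z4_pairs) O3"
proof (rule subgroup_signed_perm)
  fix p q :: "3 \<Rightarrow> 3" and s t :: "3 \<Rightarrow> real"
  assume A: "(p, s) \<in> Z4_pairs" "(q, t) \<in> Z4_pairs"
  have "s 1 * t (p 1) * (s 2 * t (p 2)) = (s 1 * s 2) * (t 1 * t 2)"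
  proof -
    have "p 1 = 1 \<and> p 2 = 2 \<or> p 1 = 2 \<and> p 2 = 1" using A(1) by (auto simp: Z4_pairs_def D4_pairs_def)
    then show ?thesis by (elim disjE) (simp_all add: ac_simps)
  qed
  moreover have "s 1 * s 2 = (if p = id then 1 else -1)" "t 1 * t 2 = (if q = id then 1 else -1)"
    using A by (auto simp: Z4_pairs_def)
  ultimately have "s 1 * t (p 1) * (s 2 * t (p 2)) =
      (if p = id then 1 else -1) * (if q = id then 1 else -1)" by simp
  also have "\<dots> = (if q \<circ> p = id then 1 else -1)"
    using A by (auto simp: Z4_pairs_def D4_pairs_def)
  finally have "s 1 * t (p 1) * (s 2 * t (p 2)) = (if q \<circ> p = id then 1 else -1)" .
  moreover have "(q \<circ> p, \<lambda>i. s i * t (p i)) \<in> D4_pairs"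
    using A by (auto simp: D4_pairs_def Z4_pairs_def intro: signs_mult)
  ultimately show "(q \<circ> p, \<lambda>i. s i * t (p i)) \<in> Z4_pairs"
    by (simp add: Z4_pairs_def)
qed (auto simp: D4_pairs_def Z4_pairs_def mult.commute)

lemma rotation_e3_signed_perm:
  "rotation_e3 (pi / 2) = signed_perm swap12 (\<lambda>i. if i = 1 then -1 else 1)"
  by (simp add: rotation_e3_def signed_perm_def vec_eq_iff forall_3)

lemma rotation_e1_signed_perm:
  "rotation_e1 pi = signed_perm id (\<lambda>i. if i = 1 then 1 else -1)"
  by (simp add: rotation_e1_def signed_perm_def vec_eq_iff forall_3)

lemma minus_one_signed_perm: "- mat 1 = signed_perm id (\<lambda>_. -1)"
  by (simp add: mat_def signed_perm_def vec_eq_iff forall_3)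

text \<open>Verifying that a tensor is invariant takes an upper bound on the group, provided by this
  inclusion; exploiting invariance takes only the membership of particular elements.\<close>

lemma plus_Z2c_subset:
  assumes "subgroup H O3" "G \<subseteq> H" "- mat 1 \<in> H"
  shows "plus_Z2c G \<subseteq> H"
  unfolding plus_Z2c_def using assms by (intro group.generate_subgroup_incl[OF group_O3]) auto

lemma rotation_e3_in_Z4_pairs: "rotation_e3 (pi / 2) \<in> (\<lambda>(p, s). signed_perm p s) ` Z4_pairs"
  unfolding rotation_e3_signed_perm
  by (rule image_eqI[of _ _ "(swap12, \<lambda>i. if i = 1 then -1 else 1)"]) (auto simp: Z4_pairs_def D4_pairs_def)

lemma minus_one_in_Z4_pairs: "- mat 1 \<in> (\<lambda>(p, s). signed_perm p s) ` Z4_pairs"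
  unfolding minus_one_signed_perm
  by (rule image_eqI[of _ _ "(id, \<lambda>_. -1)"]) (auto simp: Z4_pairs_def D4_pairs_def)

lemma rotation_e1_in_D4_pairs: "rotation_e1 pi \<in> (\<lambda>(p, s). signed_perm p s) ` D4_pairs"
  unfolding rotation_e1_signed_perm
  by (rule image_eqI[of _ _ "(id, \<lambda>i. if i = 1 then 1 else -1)"]) (auto simp: D4_pairs_def)

lemma Z4_subset: "Z4 \<subseteq> (\<lambda>(p, s). signed_perm p s) ` Z4_pairs"
  unfolding Z4_def using rotation_e3_in_Z4_pairs
  by (intro group.generate_subgroup_incl[OF group_O3] Z4_pairs_subgroup) auto

lemma plus_Z2c_Z4_subset: "plus_Z2c Z4 \<subseteq> (\<lambda>(p, s). signed_perm p s) ` Z4_pairs"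
  by (intro plus_Z2c_subset Z4_pairs_subgroup Z4_subset minus_one_in_Z4_pairs)

lemma plus_Z2c_D4_subset: "plus_Z2c D4 \<subseteq> (\<lambda>(p, s). signed_perm p s) ` D4_pairs"
proof -
  have le: "(\<lambda>(p, s). signed_perm p s) ` Z4_pairs \<subseteq> (\<lambda>(p, s). signed_perm p s) ` D4_pairs"
    by (intro image_mono) (auto simp: Z4_pairs_def)
  have "D4 \<subseteq> (\<lambda>(p, s). signed_perm p s) ` D4_pairs"
    unfolding D4_def using Z4_subset le rotation_e1_in_D4_pairs
    by (intro group.generate_subgroup_incl[OF group_O3] D4_pairs_subgroup) auto
  then show ?thesis
    using minus_one_in_Z4_pairs le by (intro plus_Z2c_subset D4_pairs_subgroup) blast+
qed

lemma plus_Z2c_incl: "Q \<in> G \<Longrightarrow> Q \<in> plus_Z2c G" "- mat 1 \<in> plus_Z2c G"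
  unfolding plus_Z2c_def by (auto intro: generate.incl)

lemma plus_Z2c_mult: "P \<in> plus_Z2c G \<Longrightarrow> Q \<in> plus_Z2c G \<Longrightarrow> P ** Q \<in> plus_Z2c G"
  using generate.eng[of P O3 _ Q] unfolding plus_Z2c_def by (simp add: O3_def)

text \<open>The reflection in the plane orthogonal to the third axis is minus the square of the
  quarter turn.\<close>

lemma reflection_in_plus_Z2c_Z4:
  "signed_perm id (\<lambda>i. if i = 3 then -1 else 1) \<in> plus_Z2c Z4"
proof -
  have "rotation_e3 (pi / 2) \<in> plus_Z2c Z4"
    by (auto simp: Z4_def intro!: plus_Z2c_incl(1) generate.incl)
  then have "- mat 1 ** (rotation_e3 (pi / 2) ** rotation_e3 (pi / 2)) \<in> plus_Z2c Z4"
    by (intro plus_Z2c_mult plus_Z2c_incl(2))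
  moreover have "(\<lambda>i. - ((if i = 1 then - 1 else 1) * (if swap12 i = 1 then - 1 else (1::real))))
      = (\<lambda>i. if i = 3 then -1 else 1)"
    by (simp add: fun_eq_iff forall_3)
  ultimately show ?thesis
    by (simp add: rotation_e3_signed_perm minus_one_signed_perm signed_perm_mult)
qed

section \<open>Invariant tensors and test materials\<close>

lemma invariant4_signed_perm:
  assumes "invariant4 G T" "signed_perm p s \<in> G"
  shows "s i1 * s i2 * s i3 * s i4 * T (p i1) (p i2) (p i3) (p i4) = T i1 i2 i3 i4"
  using assms unfolding invariant4_def
  by (auto simp: mult.assoc sum_distrib_left[symmetric] sum_signed_perm)

lemma invariant4I:
  assumes "G \<subseteq> (\<lambda>(p, s). signed_perm p s) ` K"
    and "\<And>p s i1 i2 i3 i4. (p, s) \<in> K \<Longrightarrow>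
      s i1 * s i2 * s i3 * s i4 * T (p i1) (p i2) (p i3) (p i4) = T i1 i2 i3 i4"
  shows "invariant4 G T"
  unfolding invariant4_def
proof
  fix Q assume "Q \<in> G"
  then obtain p s where "(p, s) \<in> K" "Q = signed_perm p s" using assms(1) by auto
  then show "\<forall>i1 i2 i3 i4.
     (\<Sum>j1\<in>UNIV. \<Sum>j2\<in>UNIV. \<Sum>j3\<in>UNIV. \<Sum>j4\<in>UNIV.
        Q$i1$j1 * Q$i2$j2 * Q$i3$j3 * Q$i4$j4 * T j1 j2 j3 j4) = T i1 i2 i3 i4"
    using assms(2)[of p s] by (simp add: mult.assoc sum_distrib_left[symmetric] sum_signed_perm)
qed

lemma invariant6_signed_perm:
  assumes "invariant6 G T" "signed_perm p s \<in> G"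
  shows "s i1 * s i2 * s i3 * s i4 * s i5 * s i6 * T (p i1) (p i2) (p i3) (p i4) (p i5) (p i6)
    = T i1 i2 i3 i4 i5 i6"
  using assms unfolding invariant6_def
  by (auto simp: mult.assoc sum_distrib_left[symmetric] sum_signed_perm)

lemma invariant6I:
  assumes "G \<subseteq> (\<lambda>(p, s). signed_perm p s) ` K"
    and "\<And>p s i1 i2 i3 i4 i5 i6. (p, s) \<in> K \<Longrightarrow>
      s i1 * s i2 * s i3 * s i4 * s i5 * s i6 * T (p i1) (p i2) (p i3) (p i4) (p i5) (p i6)
      = T i1 i2 i3 i4 i5 i6"
  shows "invariant6 G T"
  unfolding invariant6_def
proof
  fix Q assume "Q \<in> G"
  then obtain p s where "(p, s) \<in> K" "Q = signed_perm p s" using assms(1) by auto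
  then show "\<forall>i1 i2 i3 i4 i5 i6.
     (\<Sum>j1\<in>UNIV. \<Sum>j2\<in>UNIV. \<Sum>j3\<in>UNIV. \<Sum>j4\<in>UNIV. \<Sum>j5\<in>UNIV. \<Sum>j6\<in>UNIV.
        Q$i1$j1 * Q$i2$j2 * Q$i3$j3 * Q$i4$j4 * Q$i5$j5 * Q$i6$j6 * T j1 j2 j3 j4 j5 j6)
     = T i1 i2 i3 i4 i5 i6"
    using assms(2)[of p s] by (simp add: mult.assoc sum_distrib_left[symmetric] sum_signed_perm)
qed

text \<open>\<open>N\<close> holds the constants of the block \<open>C\<^sub>i\<^sub>i\<^sub>l\<^sub>l\<close> and \<open>S\<close> the shear moduli \<open>C\<^sub>i\<^sub>j\<^sub>i\<^sub>j\<close>, \<open>i \<noteq> j\<close>. The tensor \<open>test6 B\<close>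
  couples only the strain gradients \<open>e\<^sub>3\<^sub>j\<^sub>,\<^sub>k\<close>, so that \<open>B\<close> acts on the fourth derivatives of \<open>u\<^sub>3\<close>.\<close>

definition test4 :: "(3 \<Rightarrow> 3 \<Rightarrow> real) \<Rightarrow> (3 \<Rightarrow> 3 \<Rightarrow> real) \<Rightarrow> tensor4" where
  "test4 N S i j l m = (if i = j \<and> l = m then N i l else 0) +
     (if i \<noteq> j \<and> (i = l \<and> j = m \<or> i = m \<and> j = l) then S i j else 0)"

definition test6 :: "(3 \<Rightarrow> 3 \<Rightarrow> 3 \<Rightarrow> 3 \<Rightarrow> real) \<Rightarrow> tensor6" where
  "test6 B i j k l m n =
     (if i = 3 \<and> l = 3 then B j k m n else 0) + (if j = 3 \<and> l = 3 then B i k m n else 0) +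
     (if i = 3 \<and> m = 3 then B j k l n else 0) + (if j = 3 \<and> m = 3 then B i k l n else 0)"

text \<open>Indices of a nonzero component occur in equal pairs, so the signs cancel, and the swap
  conditions absorb the permutation. The hypotheses leave four free constants in \<open>N\<close>
  and two off the diagonal of \<open>S\<close>, together the six elastic constants of the
  class.\<close>

lemma test4_material:
  assumes "\<And>i l. N i l = N l i" "\<And>i l. S i l = S l i"
    and "\<And>i l. N (swap12 i) (swap12 l) = N i l" "\<And>i l. S (swap12 i) (swap12 l) = S i l"
  shows "(test4 N S, \<lambda>i j k l m. 0, \<lambda>i j k l m n. 0) \<in> tetragonal_Z4_Z2c"
proof -
  have "invariant4 (plus_Z2c D4) (test4 N S)"
  proof (rule invariant4I[OF plus_Z2c_D4_subset])
    fix p s i1 i2 i3 i4 assume "(p, s) \<in> D4_pairs"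
    then have ps: "p = id \<or> p = swap12" "\<And>i. s i = 1 \<or> s i = -1" by (auto simp: D4_pairs_def square_eq_1_iff)
    have sq: "s i * (s i * r) = r" "s i * s i = 1" for i r using ps(2)[of i] by auto
    have "test4 N S (p i1) (p i2) (p i3) (p i4) = test4 N S i1 i2 i3 i4"
      using ps(1) by (elim disjE) (simp_all add: test4_def assms(3,4) cong: if_cong)
    moreover have "s i1 * s i2 * s i3 * s i4 = 1" if "test4 N S i1 i2 i3 i4 \<noteq> 0"
    proof -
      have "i1 = i2 \<and> i3 = i4 \<or> i1 = i3 \<and> i2 = i4 \<or> i1 = i4 \<and> i2 = i3"
        using that by (auto simp: test4_def split: if_splits)
      then show ?thesis by (auto simp: sq ac_simps)
    qed
    ultimately show "s i1 * s i2 * s i3 * s i4 * test4 N S (p i1) (p i2) (p i3) (p i4)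
        = test4 N S i1 i2 i3 i4"
      by (cases "test4 N S i1 i2 i3 i4 = 0") simp_all
  qed
  moreover have sym: "test4 N S i j l m = test4 N S j i l m" "test4 N S i j l m = test4 N S l m i j"
    for i j l m using assms(1)[of i l] assms(2)[of i j] by (auto simp: test4_def)
  ultimately show ?thesis
    unfolding tetragonal_Z4_Z2c_def strain_gradient_materials_def invariant6_def
    by (auto intro: sym)
qed

text \<open>In each summand of \<open>test6\<close> two indices equal 3, an axis fixed by
  \<open>p\<close> up to sign; their two signs cancel, and invariance reduces to that of
  \<open>B\<close>. The four summands provide the symmetry within each strain pair, and
  \<open>sym\<close> the exchange of the two triples.\<close>

lemma test6_material:
  assumes sym: "\<And>i j k l. B i j k l = B k l i j"
    and inv: "\<And>p s i j k l. (p, s) \<in> Z4_pairs \<Longrightarrow>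
      s i * s j * s k * s l * B (p i) (p j) (p k) (p l) = B i j k l"
  shows "(\<lambda>i j l m. 0, \<lambda>i j k l m. 0, test6 B) \<in> tetragonal_Z4_Z2c"
proof -
  have "invariant6 (plus_Z2c Z4) (test6 B)"
  proof (rule invariant6I[OF plus_Z2c_Z4_subset])
    fix p s i1 i2 i3 i4 i5 i6 assume ps: "(p, s) \<in> Z4_pairs"
    then have s: "\<And>i. s i = 1 \<or> s i = -1" by (auto simp: Z4_pairs_def D4_pairs_def square_eq_1_iff)
    have p: "p i = 3 \<longleftrightarrow> i = 3" for i using ps by (auto simp: Z4_pairs_def D4_pairs_def)
    have sq: "s 3 * (s 3 * r) = r" for r using s[of 3] by auto
    note inv' = inv[OF ps, symmetric]
    \<comment> \<open>One rule for all four summands: \<open>q\<close> is the condition that two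
      indices equal 3, and \<open>a\<close>, \<open>b\<close>, \<open>c\<close>, \<open>d\<close>
      are the remaining ones.\<close>
    have *: "s i1 * s i2 * s i3 * s i4 * s i5 * s i6 *
        (if q then B (p a) (p b) (p c) (p d) else 0) = (if q then B a b c d else 0)"
      if "q \<Longrightarrow> s i1 * s i2 * s i3 * s i4 * s i5 * s i6 = s a * s b * s c * s d" for q a b c d
      using inv'[of a b c d] that by simp
    have "s 3 * s 3 = 1" using sq[of 1] by simp
    then show "s i1 * s i2 * s i3 * s i4 * s i5 * s i6 *
        test6 B (p i1) (p i2) (p i3) (p i4) (p i5) (p i6) = test6 B i1 i2 i3 i4 i5 i6"
      unfolding test6_def p distrib_left
      by (intro arg_cong2[where f = "(+)"] *) (auto simp: sq ac_simps)
  qed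
  moreover have sym6: "test6 B i j k l m n = test6 B j i k l m n" "test6 B i j k l m n = test6 B l m n i j k"
    for i j k l m n
    using sym[of j k m n] sym[of i k m n] sym[of j k l n] sym[of i k l n] by (auto simp: test6_def)
  ultimately show ?thesis
    unfolding tetragonal_Z4_Z2c_def strain_gradient_materials_def invariant4_def
    by (auto intro: sym6)
qed

subsection \<open>The equilibrium equations in displacement form\<close>

lemma sum_symmetrize:
  fixes G :: "'a::finite \<Rightarrow> 'a \<Rightarrow> real"
  shows "(\<Sum>l\<in>UNIV. \<Sum>m\<in>UNIV. (G l m + G m l) / 2) = (\<Sum>l\<in>UNIV. \<Sum>m\<in>UNIV. G l m)"
proof -
  have "(\<Sum>l\<in>UNIV. \<Sum>m\<in>UNIV. G m l) = (\<Sum>l\<in>UNIV. \<Sum>m\<in>UNIV. G l m)"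
    by (rule sum.swap)
  then show ?thesis by (simp add: sum_divide_distrib[symmetric] sum.distrib)
qed

lemma partial_mean:
  assumes "open S" "smooth_on S f" "smooth_on S g" "\<And>x. x \<in> S \<Longrightarrow> h x = (f x + g x) / 2"
    and "x \<in> S"
  shows "partial i h x = (partial i f x + partial i g x) / 2"
proof -
  have "partial i h x = partial i (\<lambda>x. (1/2) * (f x + g x)) x"
    using assms(4) by (intro partial_cong_open[OF assms(1,5)]) simp
  also have "\<dots> = (1/2) * partial i (\<lambda>x. f x + g x) x"
    using assms by (intro partial_cmult smooth_on_differentiable[where S = S] smooth_on_add)
  also have "\<dots> = (partial i f x + partial i g x) / 2"
    using assms(2,3)[THEN smooth_on_differentiable] assms(5) by (simp add: partial_add)
  finally show ?thesis .
qed

text \<open>Constant coefficients pass through the derivatives, and their symmetry in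
  \<open>l\<close> and \<open>m\<close> lets the strain be replaced by the displacement gradient, by
  \<open>sum_symmetrize\<close>.\<close>

lemma equilibrium_on_iff:
  assumes "open \<Omega>" "smooth_on \<Omega> u" "(C, \<lambda>i j k l m. 0, A) \<in> strain_gradient_materials"
  shows "equilibrium_on \<Omega> (C, \<lambda>i j k l m. 0, A) u \<longleftrightarrow> (\<forall>x\<in>\<Omega>. \<forall>i.
    (\<Sum>j\<in>UNIV. \<Sum>l\<in>UNIV. \<Sum>m\<in>UNIV. C i j l m * partial j (partial m (\<lambda>y. u y $ l)) x) -
    (\<Sum>j\<in>UNIV. \<Sum>k\<in>UNIV. \<Sum>l\<in>UNIV. \<Sum>m\<in>UNIV. \<Sum>n\<in>UNIV.
      A i j k l m n * partial k (partial j (partial n (partial m (\<lambda>y. u y $ l)))) x) = 0)"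
proof -
  define U where "U = (\<lambda>l y. u y $ l)"
  have U: "smooth_on \<Omega> (U l)" for l unfolding U_def by (rule smooth_on_component[OF assms(1,2)])
  have e: "strain u l m x = (partial m (U l) x + partial l (U m) x) / 2" for l m x
    by (simp add: strain_def U_def)
  have C': "C i j l m = C j i l m" "C i j l m = C l m i j" for i j l m
    using assms(3) unfolding strain_gradient_materials_def by simp_all
  \<comment> \<open>Symmetry in the second pair comes from symmetry in the first by exchanging the
    pairs before and after.\<close>
  have C: "C i j m l = C i j l m" for i j l m
    by (rule trans[OF C'(2) trans[OF C'(1) C'(2)]])
  have A': "A i j k l m n = A j i k l m n" "A i j k l m n = A l m n i j k" for i j k l m n
    using assms(3) unfolding strain_gradient_materials_def by simp_all
  have A: "A i j k m l n = A i j k l m n" for i j k l m n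
    by (rule trans[OF A'(2) trans[OF A'(1) A'(2)]])
  have "smooth_on \<Omega> (\<lambda>x. (1/2) * (partial m (U l) x + partial l (U m) x))" for l m
    by (intro smooth_on_mult smooth_on_add smooth_on_const smooth_on_partial U assms(1))
  then have e_smooth: "smooth_on \<Omega> (strain u l m)" for l m
    by (simp add: e[abs_def])
  have e1: "partial j (strain u l m) x = (partial j (partial m (U l)) x + partial j (partial l (U m)) x) / 2"
    if "x \<in> \<Omega>" for j l m x
    using that by (intro partial_mean[OF assms(1)] smooth_on_partial U e)
  have e2: "partial i (partial j (strain u l m)) x =
      (partial i (partial j (partial m (U l))) x + partial i (partial j (partial l (U m))) x) / 2"
    if "x \<in> \<Omega>" for i j l m x
    using that by (intro partial_mean[OF assms(1)] smooth_on_partial U e1)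
  have e3: "partial k (partial i (partial j (strain u l m))) x =
      (partial k (partial i (partial j (partial m (U l)))) x +
       partial k (partial i (partial j (partial l (U m)))) x) / 2"
    if "x \<in> \<Omega>" for i j k l m x
    using that by (intro partial_mean[OF assms(1)] smooth_on_partial U e2)
  have stress: "partial j (stress (C, \<lambda>i j k l m. 0, A) u i j) x =
      (\<Sum>l\<in>UNIV. \<Sum>m\<in>UNIV. C i j l m * partial j (partial m (U l)) x)" if "x \<in> \<Omega>" for i j x
  proof -
    have "stress (C, \<lambda>i j k l m. 0, A) u i j = (\<lambda>x. \<Sum>l\<in>UNIV. \<Sum>m\<in>UNIV. C i j l m * strain u l m x)"
      by (simp add: fun_eq_iff)
    then have "partial j (stress (C, \<lambda>i j k l m. 0, A) u i j) x =
      (\<Sum>l\<in>UNIV. \<Sum>m\<in>UNIV. C i j l m * partial j (strain u l m) x)"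
      using smooth_on_differentiable[OF e_smooth that] by (simp add: partial_sum partial_cmult)
    also have "\<dots> = (\<Sum>l\<in>UNIV. \<Sum>m\<in>UNIV. (C i j l m * partial j (partial m (U l)) x +
        C i j m l * partial j (partial l (U m)) x) / 2)"
      by (simp add: e1[OF that] C algebra_simps)
    also have "\<dots> = (\<Sum>l\<in>UNIV. \<Sum>m\<in>UNIV. C i j l m * partial j (partial m (U l)) x)"
      by (rule sum_symmetrize)
    finally show ?thesis .
  qed
  have hyper: "partial k (partial j (hyperstress (C, \<lambda>i j k l m. 0, A) u i j k)) x =
      (\<Sum>l\<in>UNIV. \<Sum>m\<in>UNIV. \<Sum>n\<in>UNIV.
        A i j k l m n * partial k (partial j (partial n (partial m (U l)))) x)"
    if "x \<in> \<Omega>" for i j k x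
  proof -
    have "hyperstress (C, \<lambda>i j k l m. 0, A) u i j k =
        (\<lambda>x. \<Sum>l\<in>UNIV. \<Sum>m\<in>UNIV. \<Sum>n\<in>UNIV. A i j k l m n * partial n (strain u l m) x)"
      by (simp add: fun_eq_iff)
    \<comment> \<open>Stated at every point of \<open>\<Omega>\<close>, since this identity is
      differentiated once more.\<close>
    then have 1: "partial j (hyperstress (C, \<lambda>i j k l m. 0, A) u i j k) x =
      (\<Sum>l\<in>UNIV. \<Sum>m\<in>UNIV. \<Sum>n\<in>UNIV. A i j k l m n * partial j (partial n (strain u l m)) x)"
      if "x \<in> \<Omega>" for x
      using smooth_on_differentiable[OF smooth_on_partial[OF e_smooth] that]
      by (simp add: partial_sum partial_cmult)
    have "partial k (partial j (hyperstress (C, \<lambda>i j k l m. 0, A) u i j k)) x =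
      partial k (\<lambda>x. \<Sum>l\<in>UNIV. \<Sum>m\<in>UNIV. \<Sum>n\<in>UNIV.
        A i j k l m n * partial j (partial n (strain u l m)) x) x"
      by (rule partial_cong_open[OF assms(1) that 1])
    also have "\<dots> = (\<Sum>l\<in>UNIV. \<Sum>m\<in>UNIV. \<Sum>n\<in>UNIV.
        A i j k l m n * partial k (partial j (partial n (strain u l m))) x)"
      using smooth_on_differentiable[OF smooth_on_partial[OF smooth_on_partial[OF e_smooth]] that]
      by (simp add: partial_sum partial_cmult)
    also have "\<dots> = (\<Sum>l\<in>UNIV. \<Sum>m\<in>UNIV.
        ((\<Sum>n\<in>UNIV. A i j k l m n * partial k (partial j (partial n (partial m (U l)))) x) +
         (\<Sum>n\<in>UNIV. A i j k m l n * partial k (partial j (partial n (partial l (U m)))) x)) / 2)"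
      by (simp add: e3[OF that] A algebra_simps sum.distrib sum_divide_distrib add_divide_distrib)
    also have "\<dots> = (\<Sum>l\<in>UNIV. \<Sum>m\<in>UNIV. \<Sum>n\<in>UNIV.
        A i j k l m n * partial k (partial j (partial n (partial m (U l)))) x)"
      by (rule sum_symmetrize)
    finally show ?thesis .
  qed
  show ?thesis
    unfolding equilibrium_on_def by (simp add: stress hyper U_def cong: ball_cong)
qed

subsection \<open>Recovering polynomials from their partial derivatives\<close>

lemma smooth_on_nth: "open S \<Longrightarrow> smooth_on S (\<lambda>x::real^'n. x $ i)"
  by (rule smooth_on_linear[OF _ bounded_linear_vec_nth])

lemma smooth_on_power:
  fixes f :: "'a::euclidean_space \<Rightarrow> 'b::real_normed_algebra_1"
  shows "open S \<Longrightarrow> smooth_on S f \<Longrightarrow> smooth_on S (\<lambda>x. f x ^ n)"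
  by (induction n) (auto intro: smooth_on_const smooth_on_mult)

lemma smooth_on_diff:
  fixes f g :: "'a::euclidean_space \<Rightarrow> 'b::real_normed_algebra_1"
  assumes "open S" "smooth_on S f" "smooth_on S g"
  shows "smooth_on S (\<lambda>x. f x - g x)"
  using smooth_on_add[OF assms(1,2) smooth_on_mult[OF assms(1) smooth_on_const[OF assms(1), of "- 1"] assms(3)]]
  by simp

lemma partial_diff:
  "f differentiable (at x) \<Longrightarrow> g differentiable (at x) \<Longrightarrow>
    partial i (\<lambda>x. f x - g x) x = partial i f x - partial i g x"
  by (rule partial_has_derivative[THEN trans])
    (auto intro!: has_derivative_diff simp: frechet_derivative_works[symmetric] partial_def)

lemma partial_minus:
  "f differentiable (at x) \<Longrightarrow> partial i (\<lambda>x. - f x) x = - partial i f x"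
  using partial_diff[of "\<lambda>_. 0" x f i] by (simp add: partial_const)

lemmas smooth_on_polynomial = smooth_on_diff smooth_on_add smooth_on_mult smooth_on_power smooth_on_const smooth_on_nth

lemma partial_power_nth:
  "partial i (\<lambda>x. (x $ j) ^ n) x = of_nat n * (x $ j) ^ (n - 1) * of_bool (i = j)"
  proof -
  have "((\<lambda>x. (x $ j) ^ n) has_derivative (\<lambda>h. of_nat n * (h $ j) * (x $ j) ^ (n - 1))) (at x)"
    by (auto intro!: derivative_eq_intros bounded_linear_imp_has_derivative bounded_linear_vec_nth)
  from partial_has_derivative[OF this] show ?thesis by (simp add: axis_def)
qed

lemma differentiable_nth: "(\<lambda>x::real^'n. x $ j) differentiable (at x)"
  using bounded_linear_imp_differentiable[OF bounded_linear_vec_nth] .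

lemmas partial_polynomial =
  partial_diff partial_minus partial_add partial_mult partial_const partial_nth partial_power_nth differentiable_nth

text \<open>Commutation is an identity on \<open>S\<close> only, so it is carried under a further
  derivative by \<open>partial_cong_open\<close>. Together with \<open>partial_commute\<close> and
  \<open>partial_commute_31\<close> it gives the adjacent transpositions that reorder four
  derivatives at will.\<close>

lemma partial_commute_21:
  assumes "open S" "smooth_on S f" "x \<in> S"
  shows "partial i (partial j (partial k f)) x = partial i (partial k (partial j f)) x"
  by (rule partial_cong_open[OF assms(1,3) partial_commute[OF assms(1,2)]])

lemma partial_commute_31:
  assumes "open S" "smooth_on S f" "x \<in> S"
  shows "partial l (partial i (partial j (partial k f))) x = partial l (partial i (partial k (partial j f))) x"
  by (rule partial_cong_open[OF assms(1,3) partial_commute_21[OF assms(1,2)]])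

lemma partial_add_eq_0:
  assumes "open S" "smooth_on S f" "smooth_on S g" "x \<in> S" "\<And>x. x \<in> S \<Longrightarrow> f x + g x = 0"
  shows "partial i f x + partial i g x = 0"
  using partial_of_constant_on[OF assms(1,4), of "\<lambda>x. f x + g x" 0 i] assms
    partial_add[OF smooth_on_differentiable smooth_on_differentiable, of S f x S g i] by simp

lemma constant_of_partials_zero:
  assumes "open S" "convex S" "smooth_on S f" "\<And>x i. x \<in> S \<Longrightarrow> partial i f x = 0"
  shows "\<exists>k. \<forall>x\<in>S. f x = k"
  using eq_plus_constant_of_partials[OF assms(1,2,3), of "\<lambda>_. 0"] assms(4) smooth_on_const[OF assms(1), of 0]
  by (simp add: partial_const)

lemma eq_plus_constant_of_partials_3:
  fixes f P :: "real^3 \<Rightarrow> real"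
  assumes "open S" "convex S" "smooth_on S f" "smooth_on S P"
    and "\<And>x. x \<in> S \<Longrightarrow> partial 1 f x = partial 1 P x" "\<And>x. x \<in> S \<Longrightarrow> partial 2 f x = partial 2 P x"
      "\<And>x. x \<in> S \<Longrightarrow> partial 3 f x = partial 3 P x"
  shows "\<exists>k. \<forall>x\<in>S. f x = P x + k"
proof (rule eq_plus_constant_of_partials[OF assms(1-4)])
  show "partial i f x = partial i P x" if "x \<in> S" for x i
    using assms(5-7)[OF that] exhaust_3[of i] by auto
qed

text \<open>Only the mixed derivatives 13 and 23 can survive. Each of their own derivatives contains
  a second derivative that vanishes, so they are constants \<open>b\<close> and \<open>a\<close>;
  integrating the gradient and then \<open>f\<close> gives the form. The values of these derivatives
  are kept in the conclusion so that coefficients of different displacement components can be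
  related.\<close>

lemma quadratic_of_partials:
  fixes f :: "real^3 \<Rightarrow> real"
  assumes "open S" "convex S" "smooth_on S f"
    and zero: "\<And>x. x \<in> S \<Longrightarrow> partial 1 (partial 1 f) x = 0" "\<And>x. x \<in> S \<Longrightarrow> partial 1 (partial 2 f) x = 0"
      "\<And>x. x \<in> S \<Longrightarrow> partial 2 (partial 2 f) x = 0" "\<And>x. x \<in> S \<Longrightarrow> partial 3 (partial 3 f) x = 0"
  shows "\<exists>a b h1 h2 h3 k. \<forall>x\<in>S. f x = a * x$2 * x$3 + b * x$1 * x$3 + (h1 * x$1 + h2 * x$2 + h3 * x$3) + k
    \<and> partial 3 (partial 1 f) x = b \<and> partial 3 (partial 2 f) x = a"
proof -
  note sm = smooth_on_partial[OF assms(3)] smooth_on_partial[OF smooth_on_partial[OF assms(3)]]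
  note comm = partial_commute[OF assms(1,3)]
  have zero': "partial 2 (partial 1 f) x = 0" if "x \<in> S" for x
    using zero(2)[OF that] comm[OF that] by simp
  have third: "partial i (partial 3 (partial 1 f)) x = 0" "partial i (partial 3 (partial 2 f)) x = 0"
    if x: "x \<in> S" for x i
  proof -
    have z: "partial 3 (partial 1 (partial 1 f)) x = 0" "partial 3 (partial 1 (partial 2 f)) x = 0"
      "partial 3 (partial 2 (partial 2 f)) x = 0" "partial 3 (partial 2 (partial 1 f)) x = 0"
      "partial 1 (partial 3 (partial 3 f)) x = 0" "partial 2 (partial 3 (partial 3 f)) x = 0"
      using partial_of_constant_on[OF assms(1) x] zero zero' by auto
    \<comment> \<open>Reordering brings a vanishing second derivative to the innermost
      position.\<close>
    have c: "partial 1 (partial 3 (partial j f)) x = partial 3 (partial 1 (partial j f)) x"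
      "partial 2 (partial 3 (partial j f)) x = partial 3 (partial 2 (partial j f)) x"
      "partial 3 (partial 3 (partial j f)) x = partial j (partial 3 (partial 3 f)) x" for j
      using partial_commute[OF assms(1) sm(1)[of j] x, of 1 3] partial_commute[OF assms(1) sm(1)[of j] x, of 2 3]
        trans[OF partial_commute_21[OF assms(1,3) x, of 3 3 j] partial_commute[OF assms(1) sm(1)[of 3] x, of 3 j]]
      by simp_all
    show "partial i (partial 3 (partial 1 f)) x = 0" "partial i (partial 3 (partial 2 f)) x = 0"
      using exhaust_3[of i] c[of 1] c[of 2] z by auto
  qed
  obtain a b where ab: "\<And>x. x \<in> S \<Longrightarrow> partial 3 (partial 1 f) x = b" "\<And>x. x \<in> S \<Longrightarrow> partial 3 (partial 2 f) x = a"
    using constant_of_partials_zero[OF assms(1,2) sm(2)] third by metis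
  have ab': "partial 1 (partial 3 f) x = b" "partial 2 (partial 3 f) x = a" if "x \<in> S" for x
    using ab[OF that] comm[OF that] by simp_all
  have "\<exists>k. \<forall>x\<in>S. partial 1 f x = b * x$3 + k"
    by (intro eq_plus_constant_of_partials_3 assms sm smooth_on_polynomial)
      (simp_all add: partial_polynomial ab zero zero')
  then obtain h1 where d1: "\<And>x. x \<in> S \<Longrightarrow> partial 1 f x = b * x$3 + h1" by auto
  have "\<exists>k. \<forall>x\<in>S. partial 2 f x = a * x$3 + k"
    by (intro eq_plus_constant_of_partials_3 assms sm smooth_on_polynomial)
      (simp_all add: partial_polynomial ab zero zero')
  then obtain h2 where d2: "\<And>x. x \<in> S \<Longrightarrow> partial 2 f x = a * x$3 + h2" by auto
  have "\<exists>k. \<forall>x\<in>S. partial 3 f x = (b * x$1 + a * x$2) + k"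
    by (intro eq_plus_constant_of_partials_3 assms sm smooth_on_polynomial)
      (simp_all add: partial_polynomial ab' zero)
  then obtain h3 where d3: "\<And>x. x \<in> S \<Longrightarrow> partial 3 f x = b * x$1 + a * x$2 + h3" by auto
  have "\<exists>k. \<forall>x\<in>S. f x = (a * x$2 * x$3 + b * x$1 * x$3 + (h1 * x$1 + h2 * x$2 + h3 * x$3)) + k"
    by (intro eq_plus_constant_of_partials_3 assms sm smooth_on_polynomial)
      (simp_all add: partial_polynomial d1 d2 d3)
  then show ?thesis using ab by (metis (no_types, lifting))
qed

text \<open>The third derivatives are constant, and harmonicity expresses all of the planar ones
  through those of type 111 and 112. The cubic terms with coefficients \<open>A\<close> and
  \<open>B\<close> are the real and imaginary parts of the cube of x1 + i x2.\<close>

lemma harmonic_cubic_of_partials: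
  fixes f :: "real^3 \<Rightarrow> real"
  assumes "open S" "convex S" "smooth_on S f"
    and z3: "\<And>x i. x \<in> S \<Longrightarrow> partial i (partial 3 f) x = 0"
    and lap: "\<And>x. x \<in> S \<Longrightarrow> partial 1 (partial 1 f) x + partial 2 (partial 2 f) x = 0"
    and fourth: "\<And>x i j k l. x \<in> S \<Longrightarrow> partial i (partial j (partial k (partial l f))) x = 0"
  shows "\<exists>A B C D h1 h2 h3 k. \<forall>x\<in>S. f x = A * ((x$1)^3 - 3 * x$1 * (x$2)^2) + B * (3 * (x$1)^2 * x$2 - (x$2)^3)
    + C * ((x$1)^2 - (x$2)^2) + D * x$1 * x$2 + (h1 * x$1 + h2 * x$2 + h3 * x$3) + k"
proof -
  note sm = smooth_on_partial[OF assms(3)]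
  note sm2 = smooth_on_partial[OF sm]
  note sm3 = smooth_on_partial[OF sm2]
  note comm = partial_commute[OF assms(1,3)]
  have z3': "partial 3 (partial i f) x = 0" if "x \<in> S" for i x
    using z3[OF that] comm[OF that] by metis
  have z3'': "partial 3 (partial i (partial j f)) x = 0" if "x \<in> S" for i j x
    using partial_commute[OF assms(1) sm that, of 3 i j] partial_of_constant_on[OF assms(1) that z3'] by simp
  have comm12: "partial 2 (partial 1 f) x = partial 1 (partial 2 f) x" if "x \<in> S" for x
    by (rule comm[OF that])
  have lap': "partial 2 (partial 2 f) x = - partial 1 (partial 1 f) x" if "x \<in> S" for x
    using lap[OF that] by simp
  obtain T1 T2 where T: "\<And>x. x \<in> S \<Longrightarrow> partial 1 (partial 1 (partial 1 f)) x = T1"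
      "\<And>x. x \<in> S \<Longrightarrow> partial 2 (partial 1 (partial 1 f)) x = T2"
    using constant_of_partials_zero[OF assms(1,2) sm3] fourth by metis
  \<comment> \<open>The divisor 6 is the 111 derivative of the cubic multiplied by \<open>A\<close>,
    and likewise the 112 derivative of the cubic multiplied by \<open>B\<close>.\<close>
  define A B where "A = T1 / 6" and "B = T2 / 6"
  have T111: "partial 1 (partial 1 (partial 1 f)) x = 6 * A" and T211: "partial 2 (partial 1 (partial 1 f)) x = 6 * B"
    if "x \<in> S" for x using T that by (simp_all add: A_def B_def)
  have T112: "partial 1 (partial 1 (partial 2 f)) x = 6 * B" if x: "x \<in> S" for x
    using partial_commute_21[OF assms(1,3) x, of 1 1 2] partial_commute[OF assms(1) sm x, of 1 2 1] T211[OF x]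
    by simp
  have T212: "partial 2 (partial 1 (partial 2 f)) x = - 6 * A" if x: "x \<in> S" for x
  proof -
    have "partial 1 (partial 1 (partial 1 f)) x + partial 1 (partial 2 (partial 2 f)) x = 0"
      by (rule partial_add_eq_0[OF assms(1) sm2 sm2 x lap])
    then show ?thesis using partial_commute[OF assms(1) sm x, of 2 1 2] T111[OF x] by simp
  qed
  have "\<exists>k. \<forall>x\<in>S. partial 1 (partial 1 f) x = (6 * A * x$1 + 6 * B * x$2) + k"
    by (intro eq_plus_constant_of_partials_3 assms sm2 smooth_on_polynomial)
      (simp_all add: partial_polynomial T111 T211 z3'')
  then obtain C' where d11: "\<And>x. x \<in> S \<Longrightarrow> partial 1 (partial 1 f) x = 6 * A * x$1 + 6 * B * x$2 + C'"
    by auto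
  define C where "C = C' / 2"
  have "\<exists>k. \<forall>x\<in>S. partial 1 (partial 2 f) x = (6 * B * x$1 - 6 * A * x$2) + k"
    by (intro eq_plus_constant_of_partials_3 assms sm2 smooth_on_polynomial)
      (simp_all add: partial_polynomial T112 T212 z3'')
  then obtain D where d12: "\<And>x. x \<in> S \<Longrightarrow> partial 1 (partial 2 f) x = 6 * B * x$1 - 6 * A * x$2 + D"
    by auto
  have "\<exists>k. \<forall>x\<in>S. partial 1 f x =
      (3 * A * (x$1)^2 + 6 * B * x$1 * x$2 - 3 * A * (x$2)^2 + 2 * C * x$1 + D * x$2) + k"
    by (intro eq_plus_constant_of_partials_3 assms sm smooth_on_polynomial)
      (simp_all add: partial_polynomial d11 comm12 d12 z3' C_def)
  then obtain h1 where d1: "\<And>x. x \<in> S \<Longrightarrow> partial 1 f x =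
      3 * A * (x$1)^2 + 6 * B * x$1 * x$2 - 3 * A * (x$2)^2 + 2 * C * x$1 + D * x$2 + h1" by auto
  have "\<exists>k. \<forall>x\<in>S. partial 2 f x =
      (3 * B * (x$1)^2 - 6 * A * x$1 * x$2 - 3 * B * (x$2)^2 - 2 * C * x$2 + D * x$1) + k"
    by (intro eq_plus_constant_of_partials_3 assms sm smooth_on_polynomial)
      (simp_all add: partial_polynomial d11 lap' d12 z3' C_def)
  then obtain h2 where d2: "\<And>x. x \<in> S \<Longrightarrow> partial 2 f x =
      3 * B * (x$1)^2 - 6 * A * x$1 * x$2 - 3 * B * (x$2)^2 - 2 * C * x$2 + D * x$1 + h2" by auto
  obtain h3 where d3: "\<And>x. x \<in> S \<Longrightarrow> partial 3 f x = h3"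
    using constant_of_partials_zero[OF assms(1,2) sm] z3 by metis
  have "\<exists>k. \<forall>x\<in>S. f x = (A * ((x$1)^3 - 3 * x$1 * (x$2)^2) + B * (3 * (x$1)^2 * x$2 - (x$2)^3)
    + C * ((x$1)^2 - (x$2)^2) + D * x$1 * x$2 + (h1 * x$1 + h2 * x$2 + h3 * x$3)) + k"
    by (intro eq_plus_constant_of_partials_3 assms smooth_on_polynomial)
      (simp_all add: partial_polynomial d1 d2 d3 algebra_simps power2_eq_square)
  then show ?thesis by (elim exE) (intro exI, assumption)
qed

section \<open>Contractions with the test tensors and the two invariant quartic forms\<close>

text \<open>In \<open>d j m l\<close> the first two arguments stand for derivatives and the last for
  the displacement component. The first sum collects the block of \<open>N\<close>, the second the
  shear moduli.\<close>

lemma test4_sum: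
  "(\<Sum>j\<in>UNIV. \<Sum>l\<in>UNIV. \<Sum>m\<in>UNIV. test4 N S i j l m * d j m l) =
    (\<Sum>l\<in>UNIV. N i l * d i l l) + (\<Sum>j\<in>UNIV. if i = j then 0 else S i j * (d j j i + d j i j))"
  using exhaust_3[of i] by (auto simp: sum_3 test4_def algebra_simps)

text \<open>With free index 3, a factor \<open>F\<close> that forces \<open>l = 3\<close>, and a
  \<open>B\<close> vanishing as soon as an index is 3, only the first of the four summands of
  \<open>test6\<close> survives.\<close>

lemma test6_sum:
  assumes F: "\<And>j k n m l. l \<noteq> 3 \<Longrightarrow> F k j n m l = 0"
    and B: "\<And>j k m n. j = 3 \<or> k = 3 \<or> m = 3 \<or> n = 3 \<Longrightarrow> B j k m n = 0"
  shows "(\<Sum>j\<in>UNIV. \<Sum>k\<in>UNIV. \<Sum>l\<in>UNIV. \<Sum>m\<in>UNIV. \<Sum>n\<in>UNIV. test6 B 3 j k l m n * F k j n m l) =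
    (\<Sum>j\<in>UNIV. \<Sum>k\<in>UNIV. \<Sum>m\<in>UNIV. \<Sum>n\<in>UNIV. B j k m n * F k j n m 3)"
proof -
  have "test6 B 3 j k l m n * F k j n m l = (if l = 3 then B j k m n * F k j n m 3 else 0)" for j k l m n :: 3
    using F[of l k j n m] B by (auto simp: test6_def)
  then have "(\<Sum>j\<in>UNIV. \<Sum>k\<in>UNIV. \<Sum>l\<in>UNIV. \<Sum>m\<in>UNIV. \<Sum>n\<in>UNIV. test6 B 3 j k l m n * F k j n m l) =
    (\<Sum>j\<in>UNIV. \<Sum>k\<in>UNIV. \<Sum>l\<in>(UNIV::3 set). \<Sum>m\<in>UNIV. \<Sum>n\<in>UNIV. if l = 3 then B j k m n * F k j n m 3 else 0)"
    by simp
  also have "\<dots> = (\<Sum>j\<in>UNIV. \<Sum>k\<in>UNIV. \<Sum>m\<in>UNIV. \<Sum>n\<in>UNIV. B j k m n * F k j n m 3)"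
    by (simp add: sum_3)
  finally show ?thesis .
qed

text \<open>The coefficients of the binary quartic forms \<open>x\<^sup>2y\<^sup>2\<close> and \<open>x\<^sup>3y - xy\<^sup>3\<close> up to scaling.\<close>

definition planar :: "3 \<Rightarrow> 3 \<Rightarrow> 3 \<Rightarrow> 3 \<Rightarrow> bool" where
  "planar j k m n \<longleftrightarrow> j \<noteq> 3 \<and> k \<noteq> 3 \<and> m \<noteq> 3 \<and> n \<noteq> 3"

definition ones :: "3 \<Rightarrow> 3 \<Rightarrow> 3 \<Rightarrow> 3 \<Rightarrow> nat" where
  "ones j k m n = of_bool (j = 1) + of_bool (k = 1) + of_bool (m = 1) + of_bool (n = 1)"

definition even_quartic :: "3 \<Rightarrow> 3 \<Rightarrow> 3 \<Rightarrow> 3 \<Rightarrow> real" where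
  "even_quartic j k m n = of_bool (planar j k m n \<and> ones j k m n = 2)"

definition odd_quartic :: "3 \<Rightarrow> 3 \<Rightarrow> 3 \<Rightarrow> 3 \<Rightarrow> real" where
  "odd_quartic j k m n = of_bool (planar j k m n \<and> ones j k m n = 3) - of_bool (planar j k m n \<and> ones j k m n = 1)"

lemma quartic_sums:
  "(\<Sum>j\<in>UNIV. \<Sum>k\<in>UNIV. \<Sum>m\<in>UNIV. \<Sum>n\<in>UNIV. even_quartic j k m n * d j k m n) =
    d 1 1 2 2 + d 1 2 1 2 + d 1 2 2 1 + d 2 1 1 2 + d 2 1 2 1 + d 2 2 1 1"
  "(\<Sum>j\<in>UNIV. \<Sum>k\<in>UNIV. \<Sum>m\<in>UNIV. \<Sum>n\<in>UNIV. odd_quartic j k m n * d j k m n) =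
    (d 1 1 1 2 + d 1 1 2 1 + d 1 2 1 1 + d 2 1 1 1) - (d 1 2 2 2 + d 2 1 2 2 + d 2 2 1 2 + d 2 2 2 1)"
  by (simp_all add: sum_3 even_quartic_def odd_quartic_def planar_def ones_def)

lemma Z4_pairs_cases:
  assumes "(p, s) \<in> Z4_pairs"
  obtains "p = id" "s 1 = 1 \<or> s 1 = -1" "s 2 = s 1" | "p = swap12" "s 1 = 1 \<or> s 1 = -1" "s 2 = - s 1"
proof -
  have s: "s 1 = 1 \<or> s 1 = -1" "s 2 = 1 \<or> s 2 = -1"
    using assms by (auto simp: Z4_pairs_def D4_pairs_def square_eq_1_iff)
  show thesis
    using assms s that by (auto simp: Z4_pairs_def D4_pairs_def)
qed

text \<open>Without the swap the two planar signs coincide and their fourth power is 1. With the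
  swap they are opposite, so the product of the signs is -1 to the number of ones, while that number
  \<open>n\<close> becomes \<open>4 - n\<close>. The even form lives at \<open>n = 2\<close>, which
  is fixed with sign 1; the odd form exchanges 3 and 1, and the sign -1 makes up for its change of
  sign.\<close>

lemma quartic_invariant:
  assumes "(p, s) \<in> Z4_pairs"
  shows "s i * s j * s k * s l * even_quartic (p i) (p j) (p k) (p l) = even_quartic i j k l"
    "s i * s j * s k * s l * odd_quartic (p i) (p j) (p k) (p l) = odd_quartic i j k l"
proof -
  have "(s i * s j * s k * s l * even_quartic (p i) (p j) (p k) (p l) = even_quartic i j k l) \<and>
    (s i * s j * s k * s l * odd_quartic (p i) (p j) (p k) (p l) = odd_quartic i j k l)"
  proof (cases "planar i j k l")
    case False
    have "p i = 3 \<longleftrightarrow> i = 3" for i using assms by (auto simp: Z4_pairs_def D4_pairs_def)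
    then have "\<not> planar (p i) (p j) (p k) (p l)" using False by (simp add: planar_def)
    then show ?thesis using False by (simp add: even_quartic_def odd_quartic_def)
  next
    case True
    then have ijkl: "i = 1 \<or> i = 2" "j = 1 \<or> j = 2" "k = 1 \<or> k = 2" "l = 1 \<or> l = 2"
      using exhaust_3 unfolding planar_def by metis+
    show ?thesis
      using assms
    proof (cases rule: Z4_pairs_cases)
      case 1
      then have "s i = s 1" "s j = s 1" "s k = s 1" "s l = s 1" using ijkl by auto
      then show ?thesis using 1 by auto
    next
      case 2
      have sign: "s i * s j * s k * s l = (-1) ^ ones i j k l"
        using ijkl 2(2) by (elim disjE) (simp_all add: 2(3) ones_def)
      have ones: "ones (p i) (p j) (p k) (p l) = 4 - ones i j k l"
        using ijkl unfolding 2(1) ones_def by (elim disjE) simp_all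
      have planar: "planar (p i) (p j) (p k) (p l)" using True by (simp add: 2(1) planar_def)
      have "ones i j k l \<le> 4" by (simp add: ones_def of_bool_def)
      then consider "ones i j k l = 0" | "ones i j k l = 1" | "ones i j k l = 2" | "ones i j k l = 3"
        | "ones i j k l = 4" by linarith
      then show ?thesis
        by cases (simp_all add: sign even_quartic_def odd_quartic_def True planar ones)
    qed
  qed
  then show "s i * s j * s k * s l * even_quartic (p i) (p j) (p k) (p l) = even_quartic i j k l"
    "s i * s j * s k * s l * odd_quartic (p i) (p j) (p k) (p l) = odd_quartic i j k l" by auto
qed

lemma quartic_symmetric: "even_quartic i j k l = even_quartic k l i j" "odd_quartic i j k l = odd_quartic k l i j"
  by (simp_all add: even_quartic_def odd_quartic_def planar_def ones_def conj_ac add_ac)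

subsection \<open>Necessary conditions\<close>

text \<open>With \<open>A = 0\<close> the equations are linear in the six elastic constants, and
  setting one of them to 1 and the others to 0 yields a separate equation for each.\<close>

lemma universal_hessian:
  assumes "open \<Omega>" "smooth_on \<Omega> u" "universal_on \<Omega> tetragonal_Z4_Z2c u" "x \<in> \<Omega>"
  defines "P \<equiv> \<lambda>j m l. partial j (partial m (\<lambda>y. u y $ l)) x"
  shows "P 1 1 1 = 0" "P 1 2 1 = 0" "P 2 2 1 = 0" "P 3 3 1 = 0"
    "P 1 1 2 = 0" "P 1 2 2 = 0" "P 2 2 2 = 0" "P 3 3 2 = 0"
    "P i 3 3 = 0" "P 1 1 3 + P 2 2 3 = 0" "P 3 1 1 + P 3 2 2 = 0"
proof -
  have P: "P j m l = P m j l" for j m l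
    unfolding P_def by (rule partial_commute[OF assms(1) smooth_on_component[OF assms(1,2)] assms(4)])
  define sym where "sym N \<longleftrightarrow> (\<forall>i l. N i l = N l i \<and> N (swap12 i) (swap12 l) = N i l)" for N :: "3 \<Rightarrow> 3 \<Rightarrow> real"
  have eq: "(\<Sum>l\<in>UNIV. N i l * P i l l) + (\<Sum>j\<in>UNIV. if i = j then 0 else S i j * (P j j i + P j i j)) = 0"
    if "sym N" "sym S" for N S i
  proof -
    have K: "(test4 N S, \<lambda>i j k l m. 0, \<lambda>i j k l m n. 0) \<in> tetragonal_Z4_Z2c"
      using that unfolding sym_def by (intro test4_material) blast+
    have "(test4 N S, \<lambda>i j k l m. 0, \<lambda>i j k l m n. 0) \<in> strain_gradient_materials"
      using K by (simp add: tetragonal_Z4_Z2c_def)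
    moreover have "equilibrium_on \<Omega> (test4 N S, \<lambda>i j k l m. 0, \<lambda>i j k l m n. 0) u"
      using assms(3) K by (simp add: universal_on_def)
    ultimately have "(\<Sum>j\<in>UNIV. \<Sum>l\<in>UNIV. \<Sum>m\<in>UNIV. test4 N S i j l m * P j m l) = 0"
      using equilibrium_on_iff[OF assms(1,2)] assms(4) by (simp add: P_def)
    then show ?thesis unfolding test4_sum .
  qed
  \<comment> \<open>The first array silences either \<open>N\<close> or \<open>S\<close>. The next
    two isolate the equal constants \<open>N 1 1\<close> and \<open>N 2 2\<close>, and
    \<open>N 3 3\<close>; the last two serve both \<open>N\<close> and \<open>S\<close>, for the
    pair 12 and for the pairs 13 and 23.\<close>
  have syms: "sym (\<lambda>i l. 0)" "sym (\<lambda>i l. of_bool (i = l \<and> i \<noteq> 3))" "sym (\<lambda>i l. of_bool (i = l \<and> i = 3))"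
    "sym (\<lambda>i l. of_bool (i \<noteq> l \<and> i \<noteq> 3 \<and> l \<noteq> 3))" "sym (\<lambda>i l. of_bool (i \<noteq> l \<and> (i = 3 \<or> l = 3)))"
    by (auto simp: sym_def)
  have N11: "P 1 1 1 = 0" "P 2 2 2 = 0"
    using eq[OF syms(2,1), of 1] eq[OF syms(2,1), of 2] by (simp_all add: sum_3)
  have N33: "P 3 3 3 = 0"
    using eq[OF syms(3,1), of 3] by (simp add: sum_3)
  have N12: "P 1 2 2 = 0" "P 2 1 1 = 0"
    using eq[OF syms(4,1), of 1] eq[OF syms(4,1), of 2] by (simp_all add: sum_3)
  have N13: "P 1 3 3 = 0" "P 2 3 3 = 0" "P 3 1 1 + P 3 2 2 = 0"
    using eq[OF syms(5,1), of 1] eq[OF syms(5,1), of 2] eq[OF syms(5,1), of 3] by (simp_all add: sum_3)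
  \<comment> \<open>The shear equations add terms that the equations for \<open>N\<close> already
    annihilate, singly or in sum, once the derivatives are commuted.\<close>
  have S12: "P 2 2 1 + P 2 1 2 = 0" "P 1 1 2 + P 1 2 1 = 0"
    using eq[OF syms(1,4), of 1] eq[OF syms(1,4), of 2] by (simp_all add: sum_3)
  have S13: "P 3 3 1 + P 3 1 3 = 0" "P 3 3 2 + P 3 2 3 = 0" "P 1 1 3 + P 1 3 1 + (P 2 2 3 + P 2 3 2) = 0"
    using eq[OF syms(1,5), of 1] eq[OF syms(1,5), of 2] eq[OF syms(1,5), of 3] by (simp_all add: sum_3)
  show "P 1 1 1 = 0" "P 2 2 2 = 0" by (rule N11)+
  show "P 1 2 2 = 0" by (rule N12)
  show "P 1 2 1 = 0" using N12(2) P[of 1 2 1] by simp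
  show "P 2 2 1 = 0" using S12(1) N12(1) P[of 2 1 2] by simp
  show "P 1 1 2 = 0" using S12(2) N12(2) P[of 2 1 1] by simp
  show "P 3 3 1 = 0" using S13(1) N13(1) P[of 3 1 3] by simp
  show "P 3 3 2 = 0" using S13(2) N13(2) P[of 3 2 3] by simp
  show "P i 3 3 = 0" using N13 N33 exhaust_3[of i] by auto
  show "P 3 1 1 + P 3 2 2 = 0" by (rule N13)
  then show "P 1 1 3 + P 2 2 3 = 0" using S13(3) P[of 1 3 1] P[of 2 3 2] by simp
qed

text \<open>The hypothesis \<open>planar\<close> removes the first two components from the third
  equilibrium equation. The even form then kills \<open>Q 1 1 2 2\<close>; the odd form and the
  Laplace equation kill \<open>Q 1 1 1 2\<close> and \<open>Q 1 2 2 2\<close>; the Laplace equation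
  carries the zero over to the pure derivatives. An index 3 anywhere gives zero by the Hessian
  conditions.\<close>

lemma universal_fourth:
  assumes "open \<Omega>" "convex \<Omega>" "smooth_on \<Omega> u" "universal_on \<Omega> tetragonal_Z4_Z2c u" "x \<in> \<Omega>"
    and planar: "\<And>k j n m l y. y \<in> \<Omega> \<Longrightarrow> l \<noteq> 3 \<Longrightarrow> partial k (partial j (partial n (partial m (\<lambda>y. u y $ l)))) y = 0"
  shows "partial k (partial j (partial n (partial m (\<lambda>y. u y $ 3)))) x = 0"
proof -
  let ?f = "\<lambda>y. u y $ 3"
  define Q where "Q k j n m = partial k (partial j (partial n (partial m ?f))) x" for k j n m
  note hess = universal_hessian[OF assms(1,3,4)]
  have sm: "smooth_on \<Omega> ?f" by (rule smooth_on_component[OF assms(1,3)])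
  note sm1 = smooth_on_partial[OF sm]
  note sm2 = smooth_on_partial[OF sm1]
  have swap: "Q k j n m = Q j k n m" "Q k j n m = Q k n j m" "Q k j n m = Q k j m n" for k j n m
    unfolding Q_def
    using partial_commute[OF assms(1) sm2 assms(5)] partial_commute_21[OF assms(1) sm1 assms(5)]
      partial_commute_31[OF assms(1) sm assms(5)] by blast+
  have "partial j (partial n (partial 3 ?f)) y = 0" if "y \<in> \<Omega>" for j n y
    using partial_of_constant_on[OF assms(1) that hess(9)] .
  then have Q3: "Q k j n 3 = 0" for k j n
    unfolding Q_def using partial_of_constant_on[OF assms(1,5)] by blast
  have third: "partial j (partial 1 (partial 1 ?f)) y + partial j (partial 2 (partial 2 ?f)) y = 0"
    if "y \<in> \<Omega>" for j y
    by (rule partial_add_eq_0[OF assms(1) sm2 sm2 that hess(10)])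
  have lap: "Q k j 1 1 + Q k j 2 2 = 0" for k j
    unfolding Q_def
    by (rule partial_add_eq_0[OF assms(1) smooth_on_partial[OF sm2] smooth_on_partial[OF sm2] assms(5) third])
  have eq: "(\<Sum>j\<in>UNIV. \<Sum>k\<in>UNIV. \<Sum>m\<in>UNIV. \<Sum>n\<in>UNIV. B j k m n * Q k j n m) = 0"
    if "\<And>i j k l. B i j k l = B k l i j"
      "\<And>p s i j k l. (p, s) \<in> Z4_pairs \<Longrightarrow> s i * s j * s k * s l * B (p i) (p j) (p k) (p l) = B i j k l"
      "\<And>j k m n. j = 3 \<or> k = 3 \<or> m = 3 \<or> n = 3 \<Longrightarrow> B j k m n = 0" for B
  proof -
    note K = test6_material[of B, OF that(1,2)]
    have "(\<lambda>i j l m. 0, \<lambda>i j k l m. 0, test6 B) \<in> strain_gradient_materials"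
      using K by (simp add: tetragonal_Z4_Z2c_def)
    moreover have "equilibrium_on \<Omega> (\<lambda>i j l m. 0, \<lambda>i j k l m. 0, test6 B) u"
      using assms(4) K by (simp add: universal_on_def)
    ultimately have "(\<Sum>j\<in>UNIV. \<Sum>k\<in>UNIV. \<Sum>l\<in>UNIV. \<Sum>m\<in>UNIV. \<Sum>n\<in>UNIV.
        test6 B 3 j k l m n * partial k (partial j (partial n (partial m (\<lambda>y. u y $ l)))) x) = 0"
      using equilibrium_on_iff[OF assms(1,3)] assms(5) by simp
    then show ?thesis
      using test6_sum[where B = B and F = "\<lambda>k j n m l. partial k (partial j (partial n (partial m (\<lambda>y. u y $ l)))) x"]
        planar[OF assms(5)] that(3) by (simp add: Q_def)
  qed
  have not_planar: "even_quartic j k m n = 0" "odd_quartic j k m n = 0"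
    if "j = 3 \<or> k = 3 \<or> m = 3 \<or> n = 3" for j k m n
    using that by (auto simp: even_quartic_def odd_quartic_def planar_def)
  \<comment> \<open>The factor counts the arrangements of two ones and two twos; the factor 4 for
    the odd form counts the positions of the single deviating index.\<close>
  have "6 * Q 1 1 2 2 = 0"
    using eq[of even_quartic, OF quartic_symmetric(1) quartic_invariant(1) not_planar(1)]
    unfolding quartic_sums by (simp add: swap)
  then have q22: "Q 1 1 2 2 = 0" by simp
  have "4 * (Q 1 1 1 2 - Q 1 2 2 2) = 0"
    using eq[of odd_quartic, OF quartic_symmetric(2) quartic_invariant(2) not_planar(2)]
    unfolding quartic_sums by (simp add: swap)
  moreover have "Q 1 1 1 2 + Q 1 2 2 2 = 0" using lap[of 1 2] by (simp add: swap)
  ultimately have q12: "Q 1 1 1 2 = 0" "Q 1 2 2 2 = 0" by auto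
  have q11: "Q 1 1 1 1 = 0" "Q 2 2 2 2 = 0" using lap[of 1 1] lap[of 2 2] q22 by (auto simp: swap)
  note zero = q22[simplified swap] q12[simplified swap] q11
  have "Q k j 3 n = 0" "Q k 3 j n = 0" "Q 3 k j n = 0" for k j n
    using Q3 swap by metis+
  then have Q_3: "Q k j n m = 0" if "k = 3 \<or> j = 3 \<or> n = 3 \<or> m = 3"
    using that Q3 by blast
  have "Q k j n m = 0"
  proof (cases "k = 3 \<or> j = 3 \<or> n = 3 \<or> m = 3")
    case False
    then have "k = 1 \<or> k = 2" "j = 1 \<or> j = 2" "n = 1 \<or> n = 2" "m = 1 \<or> m = 2"
      using exhaust_3 by metis+
    then show ?thesis by (elim disjE) (simp_all add: swap zero)
  qed (rule Q_3)
  then show ?thesis by (simp add: Q_def)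
qed

subsection \<open>Polynomials\<close>

text \<open>The coefficient of \<open>(x$a)^i * (x$b)^j\<close> is \<open>q i j\<close>; only the
  monomials that can occur in \<open>g\<close> are present. The index type is left general so that
  the same polynomial can be read on the planar projection and on space.\<close>

definition quartic :: "'n \<Rightarrow> 'n \<Rightarrow> (nat \<Rightarrow> nat \<Rightarrow> real) \<Rightarrow> real^'n \<Rightarrow> real" where
  "quartic a b q x = q 0 0 + q 1 0 * x$a + q 2 0 * (x$a)^2 + q 3 0 * (x$a)^3 + q 4 0 * (x$a)^4
    + q 0 1 * x$b + q 0 2 * (x$b)^2 + q 0 3 * (x$b)^3 + q 0 4 * (x$b)^4
    + q 1 1 * x$a * x$b + q 2 1 * (x$a)^2 * x$b + q 1 2 * x$a * (x$b)^2"

lemma partial_quartic: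
  fixes a b m n :: "'n::finite"
  assumes "a \<noteq> b"
  shows "partial n (partial m (quartic a b q)) = (\<lambda>x.
      of_bool (m = a \<and> n = a) * (2 * q 2 0 + 6 * q 3 0 * x$a + 12 * q 4 0 * (x$a)^2 + 2 * q 2 1 * x$b)
    + of_bool (m = a \<and> n = b \<or> m = b \<and> n = a) * (q 1 1 + 2 * q 2 1 * x$a + 2 * q 1 2 * x$b)
    + of_bool (m = b \<and> n = b) * (2 * q 0 2 + 6 * q 0 3 * x$b + 12 * q 0 4 * (x$b)^2 + 2 * q 1 2 * x$a))"
    and "partial k (partial j (partial n (partial m (quartic a b q)))) =
      (\<lambda>x. of_bool (m = a \<and> n = a \<and> j = a \<and> k = a) * (24 * q 4 0)
        + of_bool (m = b \<and> n = b \<and> j = b \<and> k = b) * (24 * q 0 4))"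
proof -
  define F where "F = (\<lambda>x::real^'n. q 1 0 + 2 * q 2 0 * x$a + 3 * q 3 0 * (x$a)^2 + 4 * q 4 0 * (x$a)^3
      + q 1 1 * x$b + 2 * q 2 1 * x$a * x$b + q 1 2 * (x$b)^2)"
  define G where "G = (\<lambda>x::real^'n. q 0 1 + 2 * q 0 2 * x$b + 3 * q 0 3 * (x$b)^2 + 4 * q 0 4 * (x$b)^3
      + q 1 1 * x$a + q 2 1 * (x$a)^2 + 2 * q 1 2 * x$a * x$b)"
  define Fa where "Fa = (\<lambda>x::real^'n. 2 * q 2 0 + 6 * q 3 0 * x$a + 12 * q 4 0 * (x$a)^2 + 2 * q 2 1 * x$b)"
  define Fb where "Fb = (\<lambda>x::real^'n. q 1 1 + 2 * q 2 1 * x$a + 2 * q 1 2 * x$b)"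
  define Gb where "Gb = (\<lambda>x::real^'n. 2 * q 0 2 + 6 * q 0 3 * x$b + 12 * q 0 4 * (x$b)^2 + 2 * q 1 2 * x$a)"
  define Faa where "Faa = (\<lambda>x::real^'n. 6 * q 3 0 + 24 * q 4 0 * x$a)"
  define Gbb where "Gbb = (\<lambda>x::real^'n. 6 * q 0 3 + 24 * q 0 4 * x$b)"
  note D = partial_polynomial algebra_simps fun_eq_iff
  have 1: "partial i (quartic a b q) = (if i = a then F else if i = b then G else (\<lambda>x. 0))" for i
    using assms by (simp add: D quartic_def[abs_def] F_def G_def)
  have 2: "partial i F = (if i = a then Fa else if i = b then Fb else (\<lambda>x. 0))"
    "partial i G = (if i = a then Fb else if i = b then Gb else (\<lambda>x. 0))" for i
    using assms by (simp_all add: D F_def G_def Fa_def Fb_def Gb_def)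
  have 3: "partial i Fa = (if i = a then Faa else if i = b then (\<lambda>x. 2 * q 2 1) else (\<lambda>x. 0))"
    "partial i Fb = (if i = a then (\<lambda>x. 2 * q 2 1) else if i = b then (\<lambda>x. 2 * q 1 2) else (\<lambda>x. 0))"
    "partial i Gb = (if i = a then (\<lambda>x. 2 * q 1 2) else if i = b then Gbb else (\<lambda>x. 0))" for i
    using assms by (simp_all add: D Fa_def Fb_def Gb_def Faa_def Gbb_def)
  have 4: "partial i Faa = (if i = a then (\<lambda>x. 24 * q 4 0) else (\<lambda>x. 0))"
    "partial i Gbb = (if i = b then (\<lambda>x. 24 * q 0 4) else (\<lambda>x. 0))" for i
    by (simp_all add: D Faa_def Gbb_def)
  have second: "partial n (partial m (quartic a b q)) = (\<lambda>x.
      of_bool (m = a \<and> n = a) * Fa x + of_bool (m = a \<and> n = b \<or> m = b \<and> n = a) * Fb x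
    + of_bool (m = b \<and> n = b) * Gb x)"
    using assms by (cases "m = a"; cases "m = b"; cases "n = a"; cases "n = b") (simp_all add: 1 2 partial_const)
  then show "partial n (partial m (quartic a b q)) = (\<lambda>x.
      of_bool (m = a \<and> n = a) * (2 * q 2 0 + 6 * q 3 0 * x$a + 12 * q 4 0 * (x$a)^2 + 2 * q 2 1 * x$b)
    + of_bool (m = a \<and> n = b \<or> m = b \<and> n = a) * (q 1 1 + 2 * q 2 1 * x$a + 2 * q 1 2 * x$b)
    + of_bool (m = b \<and> n = b) * (2 * q 0 2 + 6 * q 0 3 * x$b + 12 * q 0 4 * (x$b)^2 + 2 * q 1 2 * x$a))"
    unfolding Fa_def Fb_def Gb_def .
  \<comment> \<open>Outside the two pure cases the third derivative is constant; it is left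
    unevaluated here, and its vanishing derivative is supplied by the step that follows.\<close>
  have "partial j (partial n (partial m (quartic a b q))) =
      (if m = a \<and> n = a \<and> j = a then Faa else if m = b \<and> n = b \<and> j = b then Gbb
       else partial j (partial n (partial m (quartic a b q))))"
    using assms by (simp add: 1 2 3)
  moreover have "partial k (partial j (partial n (partial m (quartic a b q)))) = (\<lambda>x. 0)"
    if "\<not> (m = a \<and> n = a \<and> j = a)" "\<not> (m = b \<and> n = b \<and> j = b)"
    using assms that by (auto simp: 1 2 3 partial_const)
  ultimately show "partial k (partial j (partial n (partial m (quartic a b q)))) =
      (\<lambda>x. of_bool (m = a \<and> n = a \<and> j = a \<and> k = a) * (24 * q 4 0)
        + of_bool (m = b \<and> n = b \<and> j = b \<and> k = b) * (24 * q 0 4))"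
    using assms by (cases "m = a \<and> n = a \<and> j = a"; cases "m = b \<and> n = b \<and> j = b") (auto simp: 4)
qed

lemma smooth_on_quartic: "open S \<Longrightarrow> smooth_on S (quartic a b q)"
  unfolding quartic_def[abs_def] by (intro smooth_on_polynomial)

lemma partial_affine: "partial i (\<lambda>x. (H *v x + b) $ l) = (\<lambda>x. H $ l $ i)"
proof
  fix x
  have "bounded_linear (\<lambda>x. H *v x)" by (simp add: linear_conv_bounded_linear[symmetric])
  then have "((\<lambda>x. (H *v x + b) $ l) has_derivative (\<lambda>h. (H *v h) $ l)) (at x)"
    by (intro bounded_linear.has_derivative[OF bounded_linear_vec_nth])
      (auto intro!: derivative_eq_intros bounded_linear_imp_has_derivative)
  from partial_has_derivative[OF this] show "partial i (\<lambda>x. (H *v x + b) $ l) x = H $ l $ i"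
    by (simp add: matrix_vector_mul_component inner_axis)
qed

text \<open>Since \<open>equilibrium_on_iff\<close> involves only second and fourth derivatives, a
  homogeneous displacement drops out of the equations.\<close>

lemma partial2_add_affine:
  assumes "open S" "smooth_on S w" "\<And>x. x \<in> S \<Longrightarrow> f x = w x + (H *v x + b) $ l" "x \<in> S"
  shows "partial j (partial m f) x = partial j (partial m w) x"
proof -
  have "smooth_on S (\<lambda>x. H *v x + b)"
    by (intro smooth_on_add smooth_on_const smooth_on_linear assms(1))
      (simp add: linear_conv_bounded_linear[symmetric])
  then have aff: "smooth_on S (\<lambda>x. (H *v x + b) $ l)" by (rule smooth_on_component[OF assms(1)])
  have "partial m f x = partial m w x + H $ l $ m" if "x \<in> S" for x
  proof -
    have "partial m f x = partial m (\<lambda>x. w x + (H *v x + b) $ l) x"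
      by (rule partial_cong_open[OF assms(1) that assms(3)])
    also have "\<dots> = partial m w x + H $ l $ m"
      by (subst partial_add) (use smooth_on_differentiable[OF _ that] assms(2) aff in
        \<open>auto simp: partial_affine simp del: vector_add_component\<close>)
    finally show ?thesis .
  qed
  then have "partial j (partial m f) x = partial j (\<lambda>x. partial m w x + H $ l $ m) x"
    by (rule partial_cong_open[OF assms(1,4)])
  also have "\<dots> = partial j (partial m w) x"
    using smooth_on_differentiable[OF smooth_on_partial[OF assms(2)] assms(4)]
    by (simp add: partial_add partial_const)
  finally show ?thesis .
qed

lemma partial4_add_affine:
  assumes "open S" "smooth_on S w" "\<And>x. x \<in> S \<Longrightarrow> f x = w x + (H *v x + b) $ l" "x \<in> S"
  shows "partial k (partial i (partial j (partial m f))) x = partial k (partial i (partial j (partial m w))) x"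
  by (intro partial_cong_open[OF assms(1)] assms(4) partial2_add_affine[OF assms(1-3)])

section \<open>Functions of one variable with a constant iterated derivative\<close>

lemma has_real_derivative_deriv:
  fixes f :: "real \<Rightarrow> real"
  assumes "smooth_on S f" "s \<in> S"
  shows "(f has_real_derivative deriv f s) (at s)"
  using smooth_on_differentiable[OF assms] DERIV_deriv_iff_real_differentiable by blast

text \<open>On the real line \<open>deriv\<close> is the Frechet derivative in the direction
  \<open>1\<close>, whose smoothness is part of that of \<open>f\<close>.\<close>

lemma smooth_on_deriv:
  fixes f :: "real \<Rightarrow> real"
  assumes "open S" "smooth_on S f"
  shows "smooth_on S (deriv f)"
proof -
  have eq: "frechet_derivative f (at s) 1 = deriv f s" if "s \<in> S" for s
    using has_real_derivative_deriv[OF assms(2) that] frechet_derivative_at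
    by (metis has_field_derivative_def mult.right_neutral)
  show ?thesis
    using smooth_on_frechet[OF assms(2), of 1] Ck_on_cong[OF assms(1) eq] by (simp add: smooth_on_def)
qed

lemma eq_plus_constant_of_deriv:
  fixes f P P' :: "real \<Rightarrow> real"
  assumes "open S" "convex S" "smooth_on S f" "\<And>s. (P has_real_derivative P' s) (at s)"
    and "\<And>s. s \<in> S \<Longrightarrow> deriv f s = P' s"
  shows "\<exists>k. \<forall>s\<in>S. f s = P s + k"
proof -
  have "((\<lambda>s. f s - P s) has_real_derivative 0) (at s within S)" if "s \<in> S" for s
    using DERIV_diff[OF has_real_derivative_deriv[OF assms(3) that] assms(4)] assms(5)[OF that]
    by (simp add: has_field_derivative_at_within)
  then have "\<exists>k. \<forall>s\<in>S. f s - P s = k"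
    by (intro has_field_derivative_zero_constant[OF assms(2)]) auto
  then show ?thesis by (metis add.commute diff_add_cancel)
qed

lemma cubic_of_deriv:
  fixes f :: "real \<Rightarrow> real"
  assumes "open S" "convex S" "smooth_on S f" "\<And>s. s \<in> S \<Longrightarrow> (deriv ^^ 3) f s = c"
  shows "\<exists>a2 a1 a0. \<forall>s\<in>S. f s = c / 6 * s^3 + a2 * s^2 + a1 * s + a0"
proof -
  note sm = smooth_on_deriv[OF assms(1,3)]
  note sm2 = smooth_on_deriv[OF assms(1) sm]
  have "\<exists>k. \<forall>s\<in>S. deriv (deriv f) s = c * s + k"
    using assms(4) by (intro eq_plus_constant_of_deriv[OF assms(1,2) sm2, where P' = "\<lambda>_. c"])
      (auto intro!: derivative_eq_intros simp: numeral_3_eq_3)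
  then obtain k2 where k2: "\<And>s. s \<in> S \<Longrightarrow> deriv (deriv f) s = c * s + k2" by auto
  have "\<exists>k. \<forall>s\<in>S. deriv f s = (c / 2 * s^2 + k2 * s) + k"
    using k2 by (intro eq_plus_constant_of_deriv[OF assms(1,2) sm]) (auto intro!: derivative_eq_intros)
  then obtain k1 where k1: "\<And>s. s \<in> S \<Longrightarrow> deriv f s = c / 2 * s^2 + k2 * s + k1" by auto
  have "\<exists>k. \<forall>s\<in>S. f s = (c / 6 * s^3 + k2 / 2 * s^2 + k1 * s) + k"
    using k1 by (intro eq_plus_constant_of_deriv[OF assms(1-3)]) (auto intro!: derivative_eq_intros)
  then show ?thesis by (elim exE) (intro exI, assumption)
qed

lemma quartic_of_deriv:
  fixes f :: "real \<Rightarrow> real"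
  assumes "open S" "convex S" "smooth_on S f" "\<And>s. s \<in> S \<Longrightarrow> (deriv ^^ 4) f s = c"
  shows "\<exists>a3 a2 a1 a0. \<forall>s\<in>S. f s = c / 24 * s^4 + a3 * s^3 + a2 * s^2 + a1 * s + a0"
proof -
  have "(deriv ^^ 3) (deriv f) s = c" if "s \<in> S" for s
    using assms(4)[OF that] by (simp add: numeral_eq_Suc)
  then obtain a2 a1 a0 where a: "\<And>s. s \<in> S \<Longrightarrow> deriv f s = c / 6 * s^3 + a2 * s^2 + a1 * s + a0"
    using cubic_of_deriv[OF assms(1,2) smooth_on_deriv[OF assms(1,3)]] by metis
  have "\<exists>k. \<forall>s\<in>S. f s = (c / 24 * s^4 + a2 / 3 * s^3 + a1 / 2 * s^2 + a0 * s) + k"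
    using a by (intro eq_plus_constant_of_deriv[OF assms(1-3)]) (auto intro!: derivative_eq_intros)
  then show ?thesis by (elim exE) (intro exI, assumption)
qed

section \<open>Polynomial form of the universal displacements\<close>

text \<open>One shape for both in-plane components: coefficients \<open>c1\<close> and
  \<open>c2\<close> for the first, \<open>- c2\<close> and \<open>c3\<close> for the second.\<close>

definition bilinear_field :: "real \<Rightarrow> real \<Rightarrow> real^3 \<Rightarrow> real" where
  "bilinear_field a b x = a * x$2 * x$3 + b * x$1 * x$3"

lemma smooth_on_bilinear_field: "open S \<Longrightarrow> smooth_on S (bilinear_field a b)"
  unfolding bilinear_field_def[abs_def] by (intro smooth_on_polynomial)

lemma partial2_bilinear_field:
  "partial n (partial m (bilinear_field a b)) =
    (\<lambda>x. a * of_bool (m = 2 \<and> n = 3 \<or> m = 3 \<and> n = 2) + b * of_bool (m = 1 \<and> n = 3 \<or> m = 3 \<and> n = 1))"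
proof -
  have 1: "partial m (bilinear_field a b) =
      (\<lambda>x. of_bool (m = 1) * (b * x$3) + of_bool (m = 2) * (a * x$3) + of_bool (m = 3) * (a * x$2 + b * x$1))"
    unfolding bilinear_field_def[abs_def]
    by (rule ext) (simp add: partial_polynomial algebra_simps)
  show ?thesis
    unfolding 1 by (rule ext) (auto simp: partial_polynomial of_bool_def)
qed

text \<open>A matrix all of whose rows equal the coefficient vector serves every
  \<open>l\<close>.\<close>

lemma affine_component:
  "\<exists>(H::real^3^3) b. \<forall>x. h1 * x$1 + h2 * x$2 + h3 * x$3 + k = (H *v x + b) $ l"
proof (intro exI allI)
  fix x :: "real^3"
  show "h1 * x$1 + h2 * x$2 + h3 * x$3 + k = ((\<chi> l i. vector [h1, h2, h3] $ i) *v x + (\<chi> l. k)) $ l"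
    by (simp add: matrix_vector_mult_def sum_3)
qed

text \<open>The order matters: the quadratic form of the first two components makes their fourth
  derivatives vanish, which lets the strain-gradient equations isolate the third component and
  reduce it to a harmonic cubic.\<close>

lemma universal_imp_polynomial:
  assumes "open \<Omega>" "convex \<Omega>" "\<Omega> \<noteq> {}" "smooth_on \<Omega> u" "universal_on \<Omega> tetragonal_Z4_Z2c u"
  obtains c1 c2 c3 q and H :: "real^3^3" and b
  where "\<And>x. x \<in> \<Omega> \<Longrightarrow> u x = H *v x + b +
      vector [bilinear_field c1 c2 x, bilinear_field (- c2) c3 x, quartic 1 2 q x]"
    and "q 4 0 = 0" "q 0 4 = 0" "q 1 2 = - 3 * q 3 0" "q 2 1 = - 3 * q 0 3" "q 0 2 = - q 2 0"
proof -
  note hess = universal_hessian[OF assms(1,4,5)]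
  have sm: "smooth_on \<Omega> (\<lambda>y. u y $ l)" for l by (rule smooth_on_component[OF assms(1,4)])
  have "\<exists>a b h1 h2 h3 k. \<forall>x\<in>\<Omega>. u x $ 1 = a * x$2 * x$3 + b * x$1 * x$3 + (h1 * x$1 + h2 * x$2 + h3 * x$3) + k
    \<and> partial 3 (partial 1 (\<lambda>y. u y $ 1)) x = b \<and> partial 3 (partial 2 (\<lambda>y. u y $ 1)) x = a"
    by (rule quadratic_of_partials[OF assms(1,2) sm]) (erule hess)+
  then obtain c1 c2 h11 h12 h13 k1 where u1: "\<forall>x\<in>\<Omega>. u x $ 1 = c1 * x$2 * x$3 + c2 * x$1 * x$3 +
      (h11 * x$1 + h12 * x$2 + h13 * x$3) + k1
      \<and> partial 3 (partial 1 (\<lambda>y. u y $ 1)) x = c2 \<and> partial 3 (partial 2 (\<lambda>y. u y $ 1)) x = c1"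
    by (elim exE)
  have "\<exists>a b h1 h2 h3 k. \<forall>x\<in>\<Omega>. u x $ 2 = a * x$2 * x$3 + b * x$1 * x$3 + (h1 * x$1 + h2 * x$2 + h3 * x$3) + k
    \<and> partial 3 (partial 1 (\<lambda>y. u y $ 2)) x = b \<and> partial 3 (partial 2 (\<lambda>y. u y $ 2)) x = a"
    by (rule quadratic_of_partials[OF assms(1,2) sm]) (erule hess)+
  then obtain d c3 h21 h22 h23 k2 where u2: "\<forall>x\<in>\<Omega>. u x $ 2 = d * x$2 * x$3 + c3 * x$1 * x$3 +
      (h21 * x$1 + h22 * x$2 + h23 * x$3) + k2
      \<and> partial 3 (partial 1 (\<lambda>y. u y $ 2)) x = c3 \<and> partial 3 (partial 2 (\<lambda>y. u y $ 2)) x = d"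
    by (elim exE)
  obtain x0 where "x0 \<in> \<Omega>" using assms(3) by auto
  \<comment> \<open>The condition \<open>P 3 1 1 + P 3 2 2 = 0\<close> relates the two constants
    when evaluated at a single point, available because \<open>\<Omega>\<close> is nonempty.\<close>
  then have d: "d = - c2" using hess(11)[of x0] u1 u2 by simp
  \<comment> \<open>The predicate \<open>P\<close> absorbs the second conjuncts of \<open>u1\<close>
    and \<open>u2\<close>, so that both facts fit.\<close>
  have zero: "partial k (partial j (partial n (partial m (\<lambda>y. u y $ l)))) x = 0"
    if ul: "\<forall>x\<in>\<Omega>. u x $ l = a * x$2 * x$3 + b * x$1 * x$3 + (h1 * x$1 + h2 * x$2 + h3 * x$3) + k' \<and> P x" and x: "x \<in> \<Omega>"
    for a b h1 h2 h3 k' k j n m l x P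
  proof -
    obtain H e where "\<And>x::real^3. h1 * x$1 + h2 * x$2 + h3 * x$3 + k' = (H *v x + e) $ l"
      using affine_component[of h1 h2 h3 k' l] by metis
    then have "u x $ l = bilinear_field a b x + (H *v x + e) $ l" if "x \<in> \<Omega>" for x
      using bspec[OF ul that] unfolding bilinear_field_def by (metis add.assoc)
    from partial4_add_affine[OF assms(1) smooth_on_bilinear_field[OF assms(1)] this x]
    show ?thesis by (simp add: partial2_bilinear_field partial_const)
  qed
  have planar: "partial k (partial j (partial n (partial m (\<lambda>y. u y $ l)))) x = 0"
    if "l \<noteq> 3" "x \<in> \<Omega>" for k j n m l x
    using zero[OF u1 that(2)] zero[OF u2 that(2)] exhaust_3[of l] that(1) by auto
  have fourth: "partial k (partial j (partial n (partial m (\<lambda>y. u y $ 3)))) x = 0" if "x \<in> \<Omega>" for k j n m x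
    by (rule universal_fourth[OF assms(1,2,4,5) that planar])
  have "\<exists>A B C D h1 h2 h3 k. \<forall>x\<in>\<Omega>. u x $ 3 = A * ((x$1)^3 - 3 * x$1 * (x$2)^2)
      + B * (3 * (x$1)^2 * x$2 - (x$2)^3) + C * ((x$1)^2 - (x$2)^2) + D * x$1 * x$2
      + (h1 * x$1 + h2 * x$2 + h3 * x$3) + k"
    by (rule harmonic_cubic_of_partials[OF assms(1,2) sm]) (erule hess fourth)+
  then obtain A B C D h31 h32 h33 k3 where u3: "\<forall>x\<in>\<Omega>. u x $ 3 = A * ((x$1)^3 - 3 * x$1 * (x$2)^2)
      + B * (3 * (x$1)^2 * x$2 - (x$2)^3) + C * ((x$1)^2 - (x$2)^2) + D * x$1 * x$2
      + (h31 * x$1 + h32 * x$2 + h33 * x$3) + k3"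
    by (elim exE)
  \<comment> \<open>Rows hold the powers of \<open>x$1\<close>, columns those of \<open>x$2\<close>,
    cut off after the entries that \<open>quartic\<close> reads. Constant and linear entries are 0
    because \<open>H\<close> and the constant vector carry them.\<close>
  define q :: "nat \<Rightarrow> nat \<Rightarrow> real" where 
    "q = (\<lambda>i j. [[0, 0, - C, - B, 0], [0, D, - 3 * A], [C, 3 * B], [A], [0]] ! i ! j)"
  define H :: "real^3^3" where
    "H = vector [vector [h11, h12, h13], vector [h21, h22, h23], vector [h31, h32, h33]]"
  show thesis
  proof (rule that)
    show "u x = H *v x + vector [k1, k2, k3] +
      vector [bilinear_field c1 c2 x, bilinear_field (- c2) c3 x, quartic 1 2 q x]" if "x \<in> \<Omega>" for x
      using bspec[OF u1 that] bspec[OF u2 that] bspec[OF u3 that]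
      by (simp add: vec_eq_iff forall_3 H_def matrix_vector_mult_def sum_3 bilinear_field_def d quartic_def q_def algebra_simps)
    show "q 4 0 = 0" "q 0 4 = 0" "q 1 2 = - 3 * q 3 0" "q 2 1 = - 3 * q 0 3" "q 0 2 = - q 2 0"
      by (simp_all add: q_def)
  qed
qed

section \<open>Tensor symmetries and sufficiency of the polynomial form\<close>

text \<open>The equalities come from the quarter turn. The vanishing components come from the
  reflections that reverse only the third or only the first axis; the latter is minus the half turn
  about the first axis.\<close>

lemma tetragonal_C:
  assumes "invariant4 (plus_Z2c D4) C"
  shows "C 3 1 1 3 = C 3 2 2 3" "C 3 3 1 1 = C 3 3 2 2" "C 3 1 3 1 = C 3 2 3 2"
    and "odd (of_bool (i = 3) + of_bool (j = 3) + of_bool (k = 3) + of_bool (l = 3) :: nat) \<Longrightarrow> C i j k l = 0"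
    and "odd (of_bool (i = 1) + of_bool (j = 1) + of_bool (k = 1) + of_bool (l = 1) :: nat) \<Longrightarrow> C i j k l = 0"
proof -
  have Z4_D4: "plus_Z2c Z4 \<subseteq> plus_Z2c D4"
    unfolding plus_Z2c_def
    by (intro group.mono_generate[OF group_O3]) (auto simp: D4_def intro: generate.incl)
  have R: "signed_perm swap12 (\<lambda>i. if i = 1 then -1 else 1) \<in> plus_Z2c D4"
    unfolding rotation_e3_signed_perm[symmetric]
    by (intro plus_Z2c_incl(1)) (auto simp: D4_def Z4_def intro!: generate.incl)
  show "C 3 1 1 3 = C 3 2 2 3" "C 3 3 1 1 = C 3 3 2 2" "C 3 1 3 1 = C 3 2 3 2"
    using invariant4_signed_perm[OF assms R, of 3 1 1 3] invariant4_signed_perm[OF assms R, of 3 3 1 1]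
      invariant4_signed_perm[OF assms R, of 3 1 3 1]
    by simp_all
  have F3: "signed_perm id (\<lambda>i. if i = 3 then -1 else 1) \<in> plus_Z2c D4"
    using reflection_in_plus_Z2c_Z4 Z4_D4 by auto
  show "C i j k l = 0" if "odd (of_bool (i = 3) + of_bool (j = 3) + of_bool (k = 3) + of_bool (l = 3) :: nat)"
    using invariant4_signed_perm[OF assms F3, of i j k l] that
    by (cases "i = 3"; cases "j = 3"; cases "k = 3"; cases "l = 3") simp_all
  have "- mat 1 ** rotation_e1 pi \<in> plus_Z2c D4"
    by (intro plus_Z2c_mult plus_Z2c_incl) (auto simp: D4_def intro!: generate.incl)
  moreover have "(\<lambda>i::3. - (if i = 1 then 1 else - 1)) = (\<lambda>i. if i = 1 then -1 else (1::real))"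
    by auto
  ultimately have F1: "signed_perm id (\<lambda>i. if i = 1 then -1 else 1) \<in> plus_Z2c D4"
    by (simp add: rotation_e1_signed_perm minus_one_signed_perm signed_perm_mult)
  show "C i j k l = 0" if "odd (of_bool (i = 1) + of_bool (j = 1) + of_bool (k = 1) + of_bool (l = 1) :: nat)"
    using invariant4_signed_perm[OF assms F1, of i j k l] that
    by (cases "i = 1"; cases "j = 1"; cases "k = 1"; cases "l = 1") simp_all
qed

text \<open>The quarter turn gives the equality; reversing the third axis kills components with a
  single index 3.\<close>

lemma tetragonal_A:
  assumes "invariant6 (plus_Z2c Z4) A"
  shows "A 3 1 1 3 1 1 = A 3 2 2 3 2 2" and "i \<noteq> 3 \<Longrightarrow> A i 1 1 3 1 1 = 0" and "i \<noteq> 3 \<Longrightarrow> A i 2 2 3 2 2 = 0"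
proof -
  have R: "signed_perm swap12 (\<lambda>i. if i = 1 then -1 else 1) \<in> plus_Z2c Z4"
    unfolding rotation_e3_signed_perm[symmetric]
    by (intro plus_Z2c_incl(1)) (auto simp: Z4_def intro!: generate.incl)
  show "A 3 1 1 3 1 1 = A 3 2 2 3 2 2"
    using invariant6_signed_perm[OF assms R, of 3 1 1 3 1 1] by simp
  show "i \<noteq> 3 \<Longrightarrow> A i 1 1 3 1 1 = 0" "i \<noteq> 3 \<Longrightarrow> A i 2 2 3 2 2 = 0"
    using invariant6_signed_perm[OF assms reflection_in_plus_Z2c_Z4, of i 1 1 3 1 1]
      invariant6_signed_perm[OF assms reflection_in_plus_Z2c_Z4, of i 2 2 3 2 2] by simp_all
qed

text \<open>The elastic and strain-gradient sums vanish separately. In the latter only the two pure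
  fourth derivatives of the quartic remain, and they are opposite by hypothesis \<open>q\<close>,
  leaving a difference that \<open>tetragonal_A\<close> makes zero.\<close>

lemma polynomial_imp_universal:
  fixes H :: "real^3^3"
  assumes "open \<Omega>" "smooth_on \<Omega> u"
    and u: "\<And>x. x \<in> \<Omega> \<Longrightarrow> u x = H *v x + b +
      vector [bilinear_field c1 c2 x, bilinear_field (- c2) c3 x, quartic 1 2 q x]"
    and q: "q 0 4 = - q 4 0"
    and lap: "\<And>x. x \<in> \<Omega> \<Longrightarrow> partial 1 (partial 1 (quartic 1 2 q)) x + partial 2 (partial 2 (quartic 1 2 q)) x = 0"
  shows "universal_on \<Omega> tetragonal_Z4_Z2c u"
  unfolding universal_on_def
proof
  fix K assume "K \<in> tetragonal_Z4_Z2c"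
  then obtain C A where K: "K = (C, \<lambda>i j k l m. 0, A)" "(C, \<lambda>i j k l m. 0, A) \<in> strain_gradient_materials"
    and C: "invariant4 (plus_Z2c D4) C" and A: "invariant6 (plus_Z2c Z4) A"
    by (auto simp: tetragonal_Z4_Z2c_def)
  have uc: "u x $ 1 = bilinear_field c1 c2 x + (H *v x + b) $ 1"
    "u x $ 2 = bilinear_field (- c2) c3 x + (H *v x + b) $ 2"
    "u x $ 3 = quartic 1 2 q x + (H *v x + b) $ 3" if "x \<in> \<Omega>" for x
    using u[OF that] by simp_all
  note smooth = smooth_on_bilinear_field[OF assms(1)] smooth_on_quartic[OF assms(1)]
  show "equilibrium_on \<Omega> K u"
    unfolding K(1) equilibrium_on_iff[OF assms(1,2) K(2)]
  proof (intro ballI allI)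
    fix x i assume x: "x \<in> \<Omega>"
    note d2 = partial2_add_affine[OF assms(1) smooth(1) uc(1) x] partial2_add_affine[OF assms(1) smooth(1) uc(2) x]
      partial2_add_affine[OF assms(1) smooth(2) uc(3) x]
    note d4 = partial4_add_affine[OF assms(1) smooth(1) uc(1) x] partial4_add_affine[OF assms(1) smooth(1) uc(2) x]
      partial4_add_affine[OF assms(1) smooth(2) uc(3) x]
    have ne: "(1::3) \<noteq> 2" by simp
    \<comment> \<open>\<open>L\<close> and \<open>M\<close> are the 11 and 12 derivatives of the
      quartic at \<open>x\<close>; by \<open>lap\<close> the 22 derivative is
      \<open>- L\<close>.\<close>
    define L where "L = 2 * q 2 0 + 6 * q 3 0 * x$1 + 12 * q 4 0 * (x$1)^2 + 2 * q 2 1 * x$2"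
    define M where "M = q 1 1 + 2 * q 2 1 * x$1 + 2 * q 1 2 * x$2"
    have L: "2 * q 0 2 + 6 * q 0 3 * x$2 + 12 * q 0 4 * (x$2)^2 + 2 * q 1 2 * x$1 = - L"
      using lap[OF x] by (simp add: partial_quartic(1)[OF ne] L_def)
    have d2_3: "partial j (partial m (quartic 1 2 q)) x =
        of_bool (m = 1 \<and> j = 1) * L + of_bool (m = 1 \<and> j = 2 \<or> m = 2 \<and> j = 1) * M
        + of_bool (m = 2 \<and> j = 2) * (- L)" for j m
      by (simp only: partial_quartic(1)[OF ne] L L_def[symmetric] M_def[symmetric])
    have c: "C i j l m = 0" if "odd (of_bool (i = 3) + of_bool (j = 3) + of_bool (l = 3) + of_bool (m = 3) :: nat) \<or>
      odd (of_bool (i = 1) + of_bool (j = 1) + of_bool (l = 1) + of_bool (m = 1) :: nat)" for i j l m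
      using tetragonal_C(4,5)[OF C] that by blast
    have "(\<Sum>j\<in>UNIV. \<Sum>l\<in>UNIV. \<Sum>m\<in>UNIV. C i j l m * partial j (partial m (\<lambda>y. u y $ l)) x) =
        c1 * (C i 3 1 2 + C i 2 1 3) + c2 * (C i 3 1 1 + C i 1 1 3) - c2 * (C i 3 2 2 + C i 2 2 3)
        + c3 * (C i 3 2 1 + C i 1 2 3) + L * (C i 1 3 1 - C i 2 3 2) + M * (C i 2 3 1 + C i 1 3 2)"
      by (simp add: sum_3 d2 d2_3 partial2_bilinear_field algebra_simps)
    \<comment> \<open>For \<open>i \<noteq> 3\<close> every component has exactly one index 3. For
      \<open>i = 3\<close> the coefficients of \<open>c1\<close>, \<open>c3\<close> and
      \<open>M\<close> have exactly one index 1, and those of \<open>c2\<close> and \<open>L\<close>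
      cancel by the quarter turn.\<close>
    also have "\<dots> = 0"
      using exhaust_3[of i] by (elim disjE) (simp_all add: c tetragonal_C(1-3)[OF C])
    finally have "(\<Sum>j\<in>UNIV. \<Sum>l\<in>UNIV. \<Sum>m\<in>UNIV. C i j l m * partial j (partial m (\<lambda>y. u y $ l)) x) = 0" .
    moreover have "(\<Sum>j\<in>UNIV. \<Sum>k\<in>UNIV. \<Sum>l\<in>UNIV. \<Sum>m\<in>UNIV. \<Sum>n\<in>UNIV.
      A i j k l m n * partial k (partial j (partial n (partial m (\<lambda>y. u y $ l)))) x) = 0"
    proof -
      have "(\<Sum>j\<in>UNIV. \<Sum>k\<in>UNIV. \<Sum>l\<in>UNIV. \<Sum>m\<in>UNIV. \<Sum>n\<in>UNIV.
        A i j k l m n * partial k (partial j (partial n (partial m (\<lambda>y. u y $ l)))) x) =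
        24 * q 4 0 * (A i 1 1 3 1 1 - A i 2 2 3 2 2)"
        by (simp add: sum_3 d4 partial_quartic(2) partial2_bilinear_field partial_const q algebra_simps)
      then show ?thesis using tetragonal_A[OF A] by (cases "i = 3") simp_all
    qed
    ultimately show "(\<Sum>j\<in>UNIV. \<Sum>l\<in>UNIV. \<Sum>m\<in>UNIV. C i j l m * partial j (partial m (\<lambda>y. u y $ l)) x) -
      (\<Sum>j\<in>UNIV. \<Sum>k\<in>UNIV. \<Sum>l\<in>UNIV. \<Sum>m\<in>UNIV. \<Sum>n\<in>UNIV.
      A i j k l m n * partial k (partial j (partial n (partial m (\<lambda>y. u y $ l)))) x) = 0" by simp
  qed
qed

subsection \<open>Characterization\<close>

text \<open>The term \<open>0 * s^3\<close> keeps the derivative in the same four-coefficient shape,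
  so the equation can be applied repeatedly.\<close>

lemma deriv_cubic:
  "deriv (\<lambda>s::real. a0 + a1 * s + a2 * s^2 + a3 * s^3) = (\<lambda>s. a1 + 2 * a2 * s + 3 * a3 * s^2 + 0 * s^3)"
  by (rule ext, rule DERIV_imp_deriv) (auto intro!: derivative_eq_intros)

lemma deriv_cubic_iterate:
  "(deriv ^^ 3) (\<lambda>s::real. a0 + a1 * s + a2 * s^2 + a3 * s^3) = (\<lambda>s. 6 * a3)"
  "(deriv ^^ 4) (\<lambda>s::real. a0 + a1 * s + a2 * s^2 + a3 * s^3) = (\<lambda>s. 0)"
proof -
  have 3: "(deriv ^^ 3) f = deriv (deriv (deriv f))" and 4: "(deriv ^^ 4) f = deriv (deriv (deriv (deriv f)))"
    for f :: "real \<Rightarrow> real"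
    by (simp_all add: numeral_eq_Suc)
  show "(deriv ^^ 3) (\<lambda>s::real. a0 + a1 * s + a2 * s^2 + a3 * s^3) = (\<lambda>s. 6 * a3)"
    unfolding 3 deriv_cubic by simp
  show "(deriv ^^ 4) (\<lambda>s::real. a0 + a1 * s + a2 * s^2 + a3 * s^3) = (\<lambda>s. 0)"
    unfolding 4 deriv_cubic by simp
qed
lemma laplacian_quartic_eq_0:
  assumes "q 4 0 = 0" "q 0 4 = 0" "q 1 2 = - 3 * q 3 0" "q 2 1 = - 3 * q 0 3" "q 0 2 = - q 2 0"
  shows "partial 1 (partial 1 (quartic 1 2 q)) x + partial 2 (partial 2 (quartic 1 2 q)) (x::real^3) = 0"
proof -
  have ne: "(1::3) \<noteq> 2" by simp
  show ?thesis unfolding partial_quartic(1)[OF ne] assms by (simp add: algebra_simps)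
qed

lemma partial2_cong_open:
  "open S \<Longrightarrow> x \<in> S \<Longrightarrow> (\<And>y. y \<in> S \<Longrightarrow> f y = g y) \<Longrightarrow>
    partial i (partial j f) x = partial i (partial j g) x"
  by (intro partial_cong_open)

lemma smooth_on_cubic: "open S \<Longrightarrow> smooth_on S (\<lambda>s::real. a0 + a1 * s + a2 * s^2 + a3 * s^3)"
  by (intro smooth_on_polynomial smooth_on_linear bounded_linear_ident)

lemma open_proj12_image: "open S \<Longrightarrow> open (proj12 ` S)"
proof (erule open_surjective_linear_image)
  show "linear proj12" by (rule linearI) (simp_all add: proj12_def vec_eq_iff forall_2)
  have "proj12 (vector [y$1, y$2, 0]) = y" for y by (simp add: proj12_def vec_eq_iff forall_2)
  then show "surj proj12" by (rule surjI)
qed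

lemma quartic_proj12: "quartic 1 2 q (proj12 x) = quartic 1 2 q x"
  by (simp add: quartic_def proj12_def)

lemma laplacian_quartic_proj12:
  "(\<Sum>i\<in>UNIV. partial i (partial i (quartic 1 2 q)) (proj12 x)) =
    partial 1 (partial 1 (quartic 1 2 q)) x + partial 2 (partial 2 (quartic 1 2 q)) x"
proof -
  have "(1::2) \<noteq> 2" "(1::3) \<noteq> 2" by simp_all
  then show ?thesis by (simp add: sum_2 partial_quartic(1) proj12_def)
qed

theorem proposition3p21:
  fixes \<Omega> :: "(real^3) set" and u :: "real^3 \<Rightarrow> real^3"
  assumes "open \<Omega>" and "convex \<Omega>" and "\<Omega> \<noteq> {}"
    and "displacement_field \<Omega> u"
  shows "universal_on \<Omega> tetragonal_Z4_Z2c u \<longleftrightarrow>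
    (\<exists>(v :: real^3 \<Rightarrow> real^3) (w :: real^3 \<Rightarrow> real^3)
       (c1::real) (c2::real) (c3::real) (g :: real^2 \<Rightarrow> real)
       (f1 :: real \<Rightarrow> real) (f2 :: real \<Rightarrow> real) (f3 :: real \<Rightarrow> real) (f4 :: real \<Rightarrow> real) (c::real).
       homogeneous_on \<Omega> v \<and>
       (\<forall>x\<in>\<Omega>. w x = vector [c1 * x$2 * x$3 + c2 * x$1 * x$3,
                              - c2 * x$2 * x$3 + c3 * x$1 * x$3,
                              g (proj12 x)]) \<and>
       harmonic_on (proj12 ` \<Omega>) g \<and>
       smooth_on ((\<lambda>x. x$1) ` \<Omega>) f1 \<and> smooth_on ((\<lambda>x. x$1) ` \<Omega>) f2 \<and>
       smooth_on ((\<lambda>x. x$2) ` \<Omega>) f3 \<and> smooth_on ((\<lambda>x. x$2) ` \<Omega>) f4 \<and>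
       (\<forall>y\<in>proj12 ` \<Omega>. g y = f1 (y$1) + y$2 * f2 (y$1) + f3 (y$2) + y$1 * f4 (y$2)) \<and>
       (\<forall>s\<in>(\<lambda>x. x$1) ` \<Omega>. (deriv ^^ 3) f2 s = 0) \<and>
       (\<forall>t\<in>(\<lambda>x. x$2) ` \<Omega>. (deriv ^^ 3) f4 t = 0) \<and>
       (\<forall>t\<in>(\<lambda>x. x$2) ` \<Omega>. (deriv ^^ 4) f3 t = c) \<and>
       (\<forall>s\<in>(\<lambda>x. x$1) ` \<Omega>. - (deriv ^^ 4) f1 s = c) \<and>
       (\<forall>x\<in>\<Omega>. u x = v x + w x))"
proof (rule iffI, goal_cases)
  case 1
  note smooth = assms(4)[unfolded displacement_field_def]
  obtain c1 c2 c3 q H b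
    where u: "\<And>x. x \<in> \<Omega> \<Longrightarrow> u x = H *v x + b +
      vector [bilinear_field c1 c2 x, bilinear_field (- c2) c3 x, quartic 1 2 q x]"
    and q: "q 4 0 = 0" "q 0 4 = 0" "q 1 2 = - 3 * q 3 0" "q 2 1 = - 3 * q 0 3" "q 0 2 = - q 2 0"
    by (rule universal_imp_polynomial[OF assms(1-3) smooth 1]) (rule that)
  \<comment> \<open>The harmonic cubic is split with \<open>c = 0\<close>: terms linear in
    \<open>x$2\<close> that involve \<open>x$1\<close> go to \<open>?f2\<close>, so
    \<open>?f4\<close> carries only \<open>q 1 2\<close>. Zero terms fill the shape of
    \<open>deriv_cubic\<close>.\<close>
  let ?f1 = "\<lambda>s. q 0 0 + q 1 0 * s + q 2 0 * s^2 + q 3 0 * s^3"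
  let ?f2 = "\<lambda>s. q 0 1 + q 1 1 * s + q 2 1 * s^2 + 0 * s^3"
  let ?f3 = "\<lambda>t. 0 + 0 * t + q 0 2 * t^2 + q 0 3 * t^3"
  let ?f4 = "\<lambda>t. 0 + 0 * t + q 1 2 * t^2 + 0 * t^3"
  have "(\<Sum>i\<in>UNIV. partial i (partial i (quartic 1 2 q)) (proj12 x)) = 0" for x
    unfolding laplacian_quartic_proj12 by (rule laplacian_quartic_eq_0[OF q])
  then have harm: "harmonic_on (proj12 ` \<Omega>) (quartic 1 2 q)"
    using smooth_on_quartic[OF open_proj12_image[OF assms(1)]] by (auto simp: harmonic_on_def smooth_on_def)
  have hom: "homogeneous_on \<Omega> (\<lambda>x. H *v x + b)"
    unfolding homogeneous_on_def by blast
  have smooth_f: "smooth_on ((\<lambda>x. x$1) ` \<Omega>) ?f1" "smooth_on ((\<lambda>x. x$1) ` \<Omega>) ?f2"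
    "smooth_on ((\<lambda>x. x$2) ` \<Omega>) ?f3" "smooth_on ((\<lambda>x. x$2) ` \<Omega>) ?f4"
    by (intro smooth_on_cubic open_image_vec_nth assms(1))+
  have g: "\<forall>y\<in>proj12 ` \<Omega>. quartic 1 2 q y = ?f1 (y$1) + y$2 * ?f2 (y$1) + ?f3 (y$2) + y$1 * ?f4 (y$2)"
    by (simp add: quartic_def q algebra_simps del: One_nat_def)
  have d: "\<forall>s\<in>(\<lambda>x. x$1) ` \<Omega>. (deriv ^^ 3) ?f2 s = 0" "\<forall>t\<in>(\<lambda>x. x$2) ` \<Omega>. (deriv ^^ 3) ?f4 t = 0"
    "\<forall>t\<in>(\<lambda>x. x$2) ` \<Omega>. (deriv ^^ 4) ?f3 t = 0" "\<forall>s\<in>(\<lambda>x. x$1) ` \<Omega>. - (deriv ^^ 4) ?f1 s = 0"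
    unfolding deriv_cubic_iterate by simp_all
  have w: "\<forall>x\<in>\<Omega>. vector [bilinear_field c1 c2 x, bilinear_field (- c2) c3 x, quartic 1 2 q x] =
      (vector [c1 * x$2 * x$3 + c2 * x$1 * x$3, - c2 * x$2 * x$3 + c3 * x$1 * x$3, quartic 1 2 q (proj12 x)] :: real^3)"
    by (simp add: bilinear_field_def quartic_proj12)
  have u': "\<forall>x\<in>\<Omega>. u x = (H *v x + b) +
      vector [bilinear_field c1 c2 x, bilinear_field (- c2) c3 x, quartic 1 2 q x]"
    using u by blast
  show ?case
    by (rule exI[of _ "\<lambda>x. H *v x + b"],
      rule exI[of _ "\<lambda>x. vector [bilinear_field c1 c2 x, bilinear_field (- c2) c3 x, quartic 1 2 q x]"],
      rule exI[of _ c1], rule exI[of _ c2], rule exI[of _ c3], rule exI[of _ "quartic 1 2 q"],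
      rule exI[of _ ?f1], rule exI[of _ ?f2], rule exI[of _ ?f3], rule exI[of _ ?f4], rule exI[of _ 0],
      intro conjI) (rule hom w harm smooth_f g d u')+
next
  case 2
  note smooth = assms(4)[unfolded displacement_field_def]
  from 2 obtain v w c1 c2 c3 g f1 f2 f3 f4 c where
    v: "homogeneous_on \<Omega> v" and
    w: "\<forall>x\<in>\<Omega>. w x = vector [c1 * x$2 * x$3 + c2 * x$1 * x$3, - c2 * x$2 * x$3 + c3 * x$1 * x$3, g (proj12 x)]" and
    harm: "harmonic_on (proj12 ` \<Omega>) g" and
    f: "smooth_on ((\<lambda>x. x$1) ` \<Omega>) f1" "smooth_on ((\<lambda>x. x$1) ` \<Omega>) f2"
      "smooth_on ((\<lambda>x. x$2) ` \<Omega>) f3" "smooth_on ((\<lambda>x. x$2) ` \<Omega>) f4" and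
    g: "\<forall>y\<in>proj12 ` \<Omega>. g y = f1 (y$1) + y$2 * f2 (y$1) + f3 (y$2) + y$1 * f4 (y$2)" and
    d: "\<forall>s\<in>(\<lambda>x. x$1) ` \<Omega>. (deriv ^^ 3) f2 s = 0" "\<forall>t\<in>(\<lambda>x. x$2) ` \<Omega>. (deriv ^^ 3) f4 t = 0"
      "\<forall>t\<in>(\<lambda>x. x$2) ` \<Omega>. (deriv ^^ 4) f3 t = c" "\<forall>s\<in>(\<lambda>x. x$1) ` \<Omega>. - (deriv ^^ 4) f1 s = c" and
    u: "\<forall>x\<in>\<Omega>. u x = v x + w x"
    by (elim exE conjE)
  have dom: "open ((\<lambda>x. x$i) ` \<Omega>)" "convex ((\<lambda>x. x$i) ` \<Omega>)" for i
    by (intro open_image_vec_nth assms(1))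
      (intro convex_linear_image assms(2) bounded_linear.linear bounded_linear_vec_nth)
  obtain p3 p2 p1 p0 where f1: "\<And>s. s \<in> (\<lambda>x. x$1) ` \<Omega> \<Longrightarrow> f1 s = - c / 24 * s^4 + p3 * s^3 + p2 * s^2 + p1 * s + p0"
    using quartic_of_deriv[OF dom f(1), of "- c"] d(4) by (metis minus_equation_iff)
  obtain r2 r1 r0 where f2: "\<And>s. s \<in> (\<lambda>x. x$1) ` \<Omega> \<Longrightarrow> f2 s = 0 / 6 * s^3 + r2 * s^2 + r1 * s + r0"
    using cubic_of_deriv[OF dom f(2), of 0] d(1) by metis
  obtain t3 t2 t1 t0 where f3: "\<And>s. s \<in> (\<lambda>x. x$2) ` \<Omega> \<Longrightarrow> f3 s = c / 24 * s^4 + t3 * s^3 + t2 * s^2 + t1 * s + t0"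
    using quartic_of_deriv[OF dom f(3), of c] d(3) by metis
  obtain m2 m1 m0 where f4: "\<And>s. s \<in> (\<lambda>x. x$2) ` \<Omega> \<Longrightarrow> f4 s = 0 / 6 * s^3 + m2 * s^2 + m1 * s + m0"
    using cubic_of_deriv[OF dom f(4), of 0] d(2) by metis
  \<comment> \<open>The constant and the monomials \<open>x$1\<close>, \<open>x$2\<close> and
    \<open>x$1 * x$2\<close> each arise from two of the four functions, so their coefficients are
    sums. Opposite pure quartic terms remain here unless \<open>c = 0\<close>.\<close>
  define q :: "nat \<Rightarrow> nat \<Rightarrow> real" where
    "q = (\<lambda>i j. [[p0 + t0, t1 + r0, t2, t3, c / 24], [p1 + m0, r1 + m1, m2], [p2, r2], [p3], [- c / 24]] ! i ! j)"
  have gq: "g y = quartic 1 2 q y" if "y \<in> proj12 ` \<Omega>" for y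
  proof -
    have "y$1 \<in> (\<lambda>x. x$1) ` \<Omega>" "y$2 \<in> (\<lambda>x. x$2) ` \<Omega>"
      using that by (auto simp: proj12_def)
    then show ?thesis
      using bspec[OF g that] by (simp add: f1 f2 f3 f4 quartic_def q_def algebra_simps power2_eq_square power3_eq_cube)
  qed
  obtain H b where H: "\<And>x. x \<in> \<Omega> \<Longrightarrow> v x = H *v x + b"
    using v unfolding homogeneous_on_def by blast
  show ?case
  proof (rule polynomial_imp_universal[OF assms(1) smooth])
    show "u x = H *v x + b + vector [bilinear_field c1 c2 x, bilinear_field (- c2) c3 x, quartic 1 2 q x]"
      if "x \<in> \<Omega>" for x
      using bspec[OF u that] bspec[OF w that] H[OF that] gq[OF imageI[OF that]]
      by (simp add: bilinear_field_def quartic_proj12)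
    show "q 0 4 = - q 4 0" by (simp add: q_def)
    fix x assume x: "x \<in> \<Omega>"
    then have px: "proj12 x \<in> proj12 ` \<Omega>" by simp
    \<comment> \<open>\<open>g\<close> agrees with the quartic on the projection only, which is
      open, so their second derivatives agree there and harmonicity carries over.\<close>
    have "(\<Sum>i\<in>UNIV. partial i (partial i (quartic 1 2 q)) (proj12 x)) =
        (\<Sum>i\<in>UNIV. partial i (partial i g) (proj12 x))"
      using gq by (intro sum.cong refl partial2_cong_open[OF open_proj12_image[OF assms(1)] px]) simp
    also have "\<dots> = 0" using harm px unfolding harmonic_on_def by blast
    finally show "partial 1 (partial 1 (quartic 1 2 q)) x + partial 2 (partial 2 (quartic 1 2 q)) x = 0"
      unfolding laplacian_quartic_proj12 .
  qed
qed

end
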